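(* Let $\nu\in M_{\chi_\alpha,\sigma}(E)$, i.e. $\nu$ is a nonzero $\sigma$-finite $\chi_\alpha$-homogeneous measure on $(E,\mathcal E)$. Then the following are equivalent: (i) There exists an $E$-valued random element $Z$ such that $\nu=\nu_Z$. (ii) There exists a measurable function $f:E\to(0,\infty)$ such that $0<\int_E f(x)\,d\nu(x)<\infty$ and $0<K_f<\infty$ $\nu$-almost everywhere. (iii) The measure $\nu$ admits an admissible product gauge. (iv) For every $i=1,\ldots,q$ there exist measurable functions $g_{n,i}:E\to[0,\infty)$, $n\ge1$, such that $g_{n,i}(S_rx)=r_i\,g_{n,i}(x)$ for all $r\in G$, $x\in E$, $n\ge 1$, and the set $\bigcap_{i=1}^q\bigcup_{n\ge1}\{g_{n,i}>0\}$ is $\nu$-conull.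
   Context: Let $q\ge1$ be an integer, $(E,\mathcal E)$ an arbitrary measurable space, and $G=(0,\infty)^q$ with coordinatewise multiplication and its Borel $\sigma$-field. Let $S:G\times E\to E$, $(r,x)\mapsto S_rx$, be a jointly measurable left action: $S_{\boldsymbol 1}x=x$ with $\boldsymbol 1=(1,\ldots,1)$, and $S_r(S_sx)=S_{rs}x$. Fix $\alpha=(\alpha_1,\ldots,\alpha_q)\in(0,\infty)^q$ and put $\chi_\alpha(r)=\prod_{i=1}^q r_i^{\alpha_i}$ and $\vartheta_\alpha(dr)=\prod_{i=1}^q\alpha_i r_i^{-\alpha_i-1}\,dr_i$ (a measure on $G$). A measure $\nu$ on $(E,\mathcal E)$ is $\chi_\alpha$-homogeneous if $\nu(S_rA)=\chi_\alpha(r)^{-1}\nu(A)$ for all $r\in G$, $A\in\mathcal E$. $M_{\chi_\alpha,\sigma}(E)$ is the set of nonzero $\sigma$-finite $\chi_\alpha$-homogeneous measures. For an $E$-valued random element $Z$, $\nu_Z(A)=\mathbb E\left\{\int_G\mathbb I_A(S_rZ)\,\vartheta_\alpha(dr)\right\}$, $A\in\mathcal E$. For measurable $f:E\to[0,\infty)$, $K_f(x)=\int_G f(S_rx)\,\vartheta_\alpha(dr)\in[0,\infty]$, $x\in E$. A set $A\in\mathcal E$ is $\nu$-conull if $\nu(E\setminus A)=0$. A product gauge is a measurable map $\tau=(\tau_1,\ldots,\tau_q):E\to[0,\infty)^q$ with $\tau(S_rx)=r\tau(x)$ (coordinatewise product) for all $r\in G$, $x\in E$; it is admissible for $\nu$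 if $E_\tau:=\bigcap_{i=1}^q\{\tau_i>0\}$ is $\nu$-conull. *)

theory Defs
  imports "HOL-Probability.Probability"
begin

text \<open>
  The group \<open>(0,\<infty>)\<^sup>q\<close> is a subset of \<^typ>\<open>real ^ 'q\<close>, where \<open>q\<close> is the (nonzero) cardinality of the
  finite index type \<open>'q\<close>.  Multiplication and unit of \<^typ>\<open>real ^ 'q\<close> are coordinatewise.
  The measurable space \<open>(E, \<E>)\<close> is \<open>(space M, sets M)\<close>; no measure of \<open>M\<close> itself is ever used.
\<close>

definition posG :: "(real ^ 'q) set" where
  "posG = {r. \<forall>i. 0 < r $ i}"

definition action :: "'a measure \<Rightarrow> (real ^ 'q \<Rightarrow> 'a \<Rightarrow> 'a) \<Rightarrow> bool" where
  "action M S \<longleftrightarrow>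
     (\<lambda>(r, x). S r x) \<in> restrict_space borel posG \<Otimes>\<^sub>M M \<rightarrow>\<^sub>M M \<and>
     (\<forall>x\<in>space M. S 1 x = x) \<and>
     (\<forall>r\<in>posG. \<forall>s\<in>posG. \<forall>x\<in>space M. S r (S s x) = S (r * s) x)"

definition chi :: "real ^ 'q \<Rightarrow> real ^ 'q \<Rightarrow> real" where
  "chi \<alpha> r = (\<Prod>i\<in>UNIV. (r $ i) powr (\<alpha> $ i))"

definition theta :: "real ^ 'q \<Rightarrow> (real ^ 'q) measure" where
  "theta \<alpha> = density (restrict_space lborel posG)
     (\<lambda>r. ennreal (\<Prod>i\<in>UNIV. \<alpha> $ i * (r $ i) powr (- (\<alpha> $ i) - 1)))"

definition homogeneous ::
  "real ^ 'q \<Rightarrow> 'a measure \<Rightarrow> (real ^ 'q \<Rightarrow> 'a \<Rightarrow> 'a) \<Rightarrow> 'a measure \<Rightarrow> bool" where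
  "homogeneous \<alpha> M S \<nu> \<longleftrightarrow>
     (\<forall>r\<in>posG. \<forall>A\<in>sets M. emeasure \<nu> (S r ` A) = ennreal (inverse (chi \<alpha> r)) * emeasure \<nu> A)"

definition homogeneous_measures ::
  "real ^ 'q \<Rightarrow> 'a measure \<Rightarrow> (real ^ 'q \<Rightarrow> 'a \<Rightarrow> 'a) \<Rightarrow> 'a measure set" where
  "homogeneous_measures \<alpha> M S =
     {\<nu>. sets \<nu> = sets M \<and> emeasure \<nu> (space M) \<noteq> 0 \<and> sigma_finite_measure \<nu> \<and> homogeneous \<alpha> M S \<nu>}"

text \<open>The set function \<open>\<nu>\<^sub>Z\<close> of a random element \<open>Z\<close> defined on the probability space \<open>P\<close>.\<close>

definition nu_of ::
  "real ^ 'q \<Rightarrow> (real ^ 'q \<Rightarrow> 'a \<Rightarrow> 'a) \<Rightarrow> 'w measure \<Rightarrow> ('w \<Rightarrow> 'a) \<Rightarrow> 'a set \<Rightarrow> ennreal" where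
  "nu_of \<alpha> S P Z A = (\<integral>\<^sup>+ \<omega>. (\<integral>\<^sup>+ r. indicator A (S r (Z \<omega>)) \<partial>theta \<alpha>) \<partial>P)"

definition K ::
  "real ^ 'q \<Rightarrow> (real ^ 'q \<Rightarrow> 'a \<Rightarrow> 'a) \<Rightarrow> ('a \<Rightarrow> real) \<Rightarrow> 'a \<Rightarrow> ennreal" where
  "K \<alpha> S f x = (\<integral>\<^sup>+ r. ennreal (f (S r x)) \<partial>theta \<alpha>)"

definition conull :: "'a measure \<Rightarrow> 'a set \<Rightarrow> bool" where
  "conull \<nu> A \<longleftrightarrow> A \<in> sets \<nu> \<and> emeasure \<nu> (space \<nu> - A) = 0"

definition product_gauge ::
  "'a measure \<Rightarrow> (real ^ 'q \<Rightarrow> 'a \<Rightarrow> 'a) \<Rightarrow> ('a \<Rightarrow> real ^ 'q) \<Rightarrow> bool" where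
  "product_gauge M S \<tau> \<longleftrightarrow>
     \<tau> \<in> borel_measurable M \<and>
     (\<forall>x\<in>space M. \<forall>i. 0 \<le> \<tau> x $ i) \<and>
     (\<forall>r\<in>posG. \<forall>x\<in>space M. \<tau> (S r x) = r * \<tau> x)"

definition admissible :: "'a measure \<Rightarrow> ('a \<Rightarrow> real ^ 'q) \<Rightarrow> bool" where
  "admissible \<nu> \<tau> \<longleftrightarrow> conull \<nu> (\<Inter>i. {x\<in>space \<nu>. 0 < \<tau> x $ i})"

text \<open>
  \<open>\<nu>\<^sub>Z\<close> depends on \<open>Z\<close> only through its law, so existence of a random element on some probability
  space, over whatever type, amounts to existence of one on a probability space over the type of
  \<open>E\<close> itself.
\<close>

lemma sigma_finite_theta: "sigma_finite_measure (theta (\<alpha> :: real ^ 'q))"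
proof -
  have "posG = (\<Inter>i. {r :: real ^ 'q. 0 < r $ i})"
    by (auto simp: posG_def)
  moreover have "open (\<Inter>i. {r :: real ^ 'q. 0 < r $ i})"
    by (intro open_INT) (auto intro!: open_Collect_less continuous_intros)
  ultimately have "open (posG :: (real ^ 'q) set)" by simp
  then have "(posG :: (real ^ 'q) set) \<in> sets lborel" by simp
  then interpret sigma_finite_measure "restrict_space lborel (posG :: (real ^ 'q) set)"
    by (rule sigma_finite_measure_restrict_space[OF sigma_finite_lborel])
  show ?thesis
    unfolding theta_def
    by (subst sigma_finite_iff_density_finite) (auto intro!: measurable_restrict_space1)
qed

lemma nu_of_distr:
  fixes S :: "real ^ 'q \<Rightarrow> 'a \<Rightarrow> 'a"
  assumes "action M S" and Z: "Z \<in> P \<rightarrow>\<^sub>M M" and A[measurable]: "A \<in> sets M"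
  shows "nu_of \<alpha> S P Z A = nu_of \<alpha> S (distr P M Z) (\<lambda>x. x) A"
proof -
  interpret sigma_finite_measure "theta \<alpha>" by (rule sigma_finite_theta)
  have "sets (theta \<alpha>) = sets (restrict_space borel posG)"
    unfolding theta_def by (simp add: sets_restrict_space)
  then have "(\<lambda>(r, x). S r x) \<in> theta \<alpha> \<Otimes>\<^sub>M M \<rightarrow>\<^sub>M M"
    using assms(1) unfolding action_def by (simp cong: measurable_cong_sets sets_pair_measure_cong)
  then have "(\<lambda>p. S (snd p) (fst p)) \<in> M \<Otimes>\<^sub>M theta \<alpha> \<rightarrow>\<^sub>M M"
    using measurable_compose[OF measurable_pair_swap'] by (fastforce simp: case_prod_beta)
  then have [measurable]: "(\<lambda>(x, r). S r x) \<in> M \<Otimes>\<^sub>M theta \<alpha> \<rightarrow>\<^sub>M M"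
    by (simp add: case_prod_beta)
  have "(\<lambda>x. \<integral>\<^sup>+ r. indicator A (S r x) \<partial>theta \<alpha>) \<in> borel_measurable M"
    by measurable
  then show ?thesis
    unfolding nu_of_def using Z by (simp add: nn_integral_distr)
qed

end

theory Submission
  imports Defs
begin

text \<open>
  Write \<open>\<theta>\<close> for \<open>theta \<alpha>\<close>, \<open>\<chi>\<close> for \<open>chi \<alpha>\<close> and \<open>K\<^sub>f\<close> for \<open>K \<alpha> S f\<close>.  All
  four conditions say in some way that \<open>\<nu>\<close>-almost every orbit looks like the group itself, and the
  proof turns one witness into another by averaging over orbits.  The only analytic input is the scaling rule
  \<open>\<integral> F (r u) \<theta>(dr) = \<chi>(u) \<integral> F d\<theta>\<close> (\<open>nn_integral_theta_scale\<close>).  It gives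
  \<open>K\<^sub>f (S\<^sub>u x) = \<chi>(u) K\<^sub>f x\<close>, and it says that \<open>\<chi> \<theta>\<close> is a Haar measure of the group; being the
  Haar measure of an abelian group, \<open>\<chi> \<theta>\<close> is invariant under inversion (\<open>haar_vinv\<close>).

  From (i) to (ii).  Take any \<open>f > 0\<close> with \<open>\<integral> f d\<nu> < \<infinity>\<close>.  If \<open>\<nu> = \<nu>\<^sub>Z\<close>, this integral is the
  expectation of \<open>K\<^sub>f Z\<close>, so \<open>K\<^sub>f Z\<close> is almost surely finite.  Finiteness of \<open>K\<^sub>f\<close> is constant on
  orbits, and \<open>\<nu>\<^sub>Z\<close> only charges orbits of values of \<open>Z\<close>.

  From (ii) to (i).  Normalise \<open>f\<close> to a probability density with respect to \<open>\<nu>\<close>, and let \<open>Z\<close> move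
  the random point \<open>x\<close> along its orbit to a place where \<open>K\<^sub>f\<close> equals \<open>1\<close>.  By the
  scaling rule this move contributes the factor \<open>1 / K\<^sub>f x\<close>, so
  \<open>\<nu>\<^sub>Z(A) = \<integral> (f x / K\<^sub>f x) \<theta>{r. S\<^sub>r x \<in> A} \<nu>(dx)\<close>.  Homogeneity of \<open>\<nu>\<close> moves the group element from
  \<open>A\<close> to the weight (\<open>homogeneous_exchange\<close>), and the orbit integral of the weight \<open>f / K\<^sub>f\<close> with
  respect to the Haar measure is \<open>1\<close>; hence \<open>\<nu>\<^sub>Z(A) = \<nu>(A)\<close>.

  From (ii) to (iii).  When \<open>0 < K\<^sub>f x < \<infinity>\<close>, the measure \<open>f (S\<^sub>r x) \<theta>(dr) / K\<^sub>f x\<close> is a probability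
  on the group, and replacing \<open>x\<close> by \<open>S\<^sub>u x\<close> divides its coordinates by those of \<open>u\<close>.  The reciprocals of
  the medians of its coordinates therefore form a product gauge.

  From (iii) to (ii).  Let \<open>f\<close> be the minimum of a \<open>\<nu>\<close>-integrable positive function and \<open>p \<circ> \<tau>\<close>, where \<open>p > 0\<close> is
  \<open>\<theta>\<close>-integrable.  Then \<open>K\<^sub>f x \<le> \<integral> p (r \<tau> x) \<theta>(dr) = \<chi>(\<tau> x) \<integral> p d\<theta>\<close> wherever \<open>\<tau>\<close> is positive.

  Between (iii) and (iv).  A gauge is a constant sequence of such functions.  Conversely, the first index \<open>n\<close>
  at which \<open>g\<^bsub>n,i\<^esub>\<close> is positive is constant on orbits, so selecting it in each coordinate keeps the
  transformation rule.
\<close>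

section \<open>The group of positive vectors\<close>

lemma borel_measurable_vec_iff:
  fixes f :: "'b \<Rightarrow> real ^ 'q"
  shows "f \<in> borel_measurable N \<longleftrightarrow> (\<forall>i. (\<lambda>x. f x $ i) \<in> borel_measurable N)"
  by (subst borel_measurable_euclidean_space) (auto simp: Basis_vec_def inner_axis)

lemma measurable_vec_nth[measurable (raw)]:
  fixes f :: "'b \<Rightarrow> real ^ 'q"
  shows "f \<in> borel_measurable N \<Longrightarrow> (\<lambda>x. f x $ i) \<in> borel_measurable N"
  by (simp add: borel_measurable_vec_iff)

lemma open_posG: "open (posG :: (real ^ 'q) set)"
proof -
  have "posG = (\<Inter>i. {r :: real ^ 'q. 0 < r $ i})"
    by (auto simp: posG_def)
  also have "open \<dots>"
    by (intro open_INT) (auto intro!: open_Collect_less continuous_intros)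
  finally show ?thesis .
qed

lemma posG_borel[measurable]: "posG \<in> sets (borel :: (real ^ 'q) measure)"
  using open_posG by (rule borel_open)

lemma space_theta[simp]: "space (theta \<alpha>) = posG"
  by (simp add: theta_def space_restrict_space)

lemma sets_theta: "sets (theta \<alpha>) = sets (restrict_space borel posG)"
  by (simp add: theta_def sets_restrict_space)

lemma measurable_theta_D: "f \<in> N \<rightarrow>\<^sub>M theta \<alpha> \<Longrightarrow> f \<in> borel_measurable N"
  by (simp add: measurable_cong_sets[OF refl sets_theta] measurable_restrict_space2_iff)

lemma measurable_theta_nth[measurable (raw)]:
  "f \<in> N \<rightarrow>\<^sub>M theta \<alpha> \<Longrightarrow> (\<lambda>x. f x $ i) \<in> borel_measurable N"
  by (intro measurable_vec_nth measurable_theta_D)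

lemma measurable_thetaI:
  assumes "\<And>i. (\<lambda>x. f x $ i) \<in> borel_measurable N" "\<And>x. x \<in> space N \<Longrightarrow> f x \<in> posG"
  shows "f \<in> N \<rightarrow>\<^sub>M theta \<alpha>"
  using assms
  by (auto simp: measurable_cong_sets[OF refl sets_theta] measurable_restrict_space2_iff
      borel_measurable_vec_iff)

definition vinv :: "real ^ 'q \<Rightarrow> real ^ 'q" where
  "vinv r = (\<chi> i. inverse (r $ i))"

lemma one_posG[simp]: "1 \<in> posG"
  and mult_posG[simp]: "r \<in> posG \<Longrightarrow> s \<in> posG \<Longrightarrow> r * s \<in> posG"
  and vinv_posG[simp]: "r \<in> posG \<Longrightarrow> vinv r \<in> posG"
  and vinv_mult: "r \<in> posG \<Longrightarrow> r * vinv r = 1" "r \<in> posG \<Longrightarrow> vinv r * r = 1"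
  by (auto simp: posG_def vinv_def vec_eq_iff less_le)

lemma posG_mult_pos_iff: "u \<in> posG \<Longrightarrow> 0 < u $ i * s \<longleftrightarrow> 0 < s"
  using mult_less_cancel_left_pos[of "u $ i" 0 s] by (simp add: posG_def)

lemma measurable_theta_mult[measurable (raw)]:
  assumes [measurable]: "f \<in> N \<rightarrow>\<^sub>M theta \<alpha>" "g \<in> N \<rightarrow>\<^sub>M theta \<alpha>"
  shows "(\<lambda>x. f x * g x) \<in> N \<rightarrow>\<^sub>M theta \<alpha>"
  using assms[THEN measurable_space] by (intro measurable_thetaI) auto

lemma measurable_theta_vinv[measurable (raw)]:
  assumes [measurable]: "f \<in> N \<rightarrow>\<^sub>M theta \<alpha>"
  shows "(\<lambda>x. vinv (f x)) \<in> N \<rightarrow>\<^sub>M theta \<alpha>"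
  using assms[THEN measurable_space] by (intro measurable_thetaI) (auto simp: vinv_def posG_def)

lemma measurable_chi[measurable (raw)]:
  assumes [measurable]: "f \<in> N \<rightarrow>\<^sub>M theta \<alpha>"
  shows "(\<lambda>x. chi \<beta> (f x)) \<in> borel_measurable N"
  unfolding chi_def by measurable

lemma chi_pos: "r \<in> posG \<Longrightarrow> 0 < chi \<alpha> r"
  unfolding chi_def posG_def by (rule prod_pos) (simp add: less_imp_neq[THEN not_sym])

lemma chi_mult: "r \<in> posG \<Longrightarrow> s \<in> posG \<Longrightarrow> chi \<alpha> (r * s) = chi \<alpha> r * chi \<alpha> s"
  by (simp add: chi_def posG_def powr_mult less_imp_le prod.distrib)

lemma chi_vinv: "r \<in> posG \<Longrightarrow> chi \<alpha> (vinv r) = inverse (chi \<alpha> r)"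
  by (simp add: chi_def posG_def vinv_def inverse_powr less_imp_le prod_inversef flip: prod_inversef)

section \<open>Scaling and inversion of \<open>\<theta>\<close>\<close>

lemma nn_integral_lborel_diagonal:
  fixes u :: "real ^ 'q" and g :: "real ^ 'q \<Rightarrow> ennreal"
  assumes u: "u \<in> posG" and g: "g \<in> borel_measurable borel"
  shows "(\<integral>\<^sup>+ r. g r \<partial>lborel) = ennreal (\<Prod>i\<in>UNIV. u $ i) * (\<integral>\<^sup>+ r. g (u * r) \<partial>lborel)"
proof -
  let ?c = "\<lambda>j :: real ^ 'q. u \<bullet> j"
  let ?T = "\<lambda>x :: real ^ 'q. 0 + (\<Sum>j\<in>Basis. (?c j * (x \<bullet> j)) *\<^sub>R j)"
  have c: "?c j \<noteq> 0" if "j \<in> Basis" for j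
    using that u by (auto simp: Basis_vec_def inner_axis posG_def less_le)
  have T: "?T x = u * x" for x
    by (rule euclidean_eqI) (auto simp: inner_sum_left inner_Basis if_distrib Basis_vec_def inner_axis
        axis_eq_axis cong: if_cong, (simp add: sum.delta inner_axis axis_def)?)
  have P: "(\<Prod>j\<in>Basis. \<bar>?c j\<bar>) = (\<Prod>i\<in>UNIV. u $ i)"
  proof -
    have B: "Basis = (\<lambda>i. axis i (1::real)) ` (UNIV :: 'q set)"
      by (auto simp: Basis_vec_def)
    show ?thesis
      unfolding B using u
      by (subst prod.reindex) (auto simp: inj_on_def axis_eq_axis inner_axis posG_def less_imp_le intro!: prod.cong)
  qed
  have [measurable]: "(\<lambda>x. u * x) \<in> borel_measurable borel"
    by (simp add: borel_measurable_vec_iff)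
  note g[measurable]
  have "(\<integral>\<^sup>+ r. g r \<partial>lborel) = (\<integral>\<^sup>+ r. g r \<partial>density (distr lborel borel (\<lambda>x. u * x)) (\<lambda>_. ennreal (\<Prod>i\<in>UNIV. u $ i)))"
    using lborel_affine_euclidean[of ?c 0, OF c] unfolding T P by simp
  also have "\<dots> = ennreal (\<Prod>i\<in>UNIV. u $ i) * (\<integral>\<^sup>+ r. g (u * r) \<partial>lborel)"
    by (simp add: nn_integral_density nn_integral_distr nn_integral_cmult)
  finally show ?thesis .
qed

text \<open>
  This is the density inside \<^const>\<open>theta\<close>, separated from the restriction to \<^const>\<open>posG\<close>; in
  \<open>nn_integral_theta\<close> the restriction becomes an indicator, so that Lebesgue measure can be rescaled on
  the whole space.
\<close>

definition theta_density :: "real ^ 'q \<Rightarrow> real ^ 'q \<Rightarrow> real" where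
  "theta_density \<alpha> r = (\<Prod>i\<in>UNIV. \<alpha> $ i * (r $ i) powr (- (\<alpha> $ i) - 1))"

lemma theta_density_measurable[measurable]: "theta_density \<alpha> \<in> borel_measurable borel"
  unfolding theta_density_def by measurable

lemma nn_integral_theta:
  assumes [measurable]: "g \<in> borel_measurable (theta \<alpha>)"
  shows "(\<integral>\<^sup>+ r. g r \<partial>theta \<alpha>) = (\<integral>\<^sup>+ r. ennreal (theta_density \<alpha> r) * g r * indicator posG r \<partial>lborel)"
proof -
  have [measurable]: "g \<in> borel_measurable (restrict_space lborel posG)"
    using assms by (simp add: theta_def)
  have [measurable]: "theta_density \<alpha> \<in> borel_measurable (restrict_space lborel posG)"
    by (simp add: measurable_restrict_space1)
  have "(\<integral>\<^sup>+ r. g r \<partial>theta \<alpha>) = (\<integral>\<^sup>+ r. ennreal (theta_density \<alpha> r) * g r \<partial>restrict_space lborel posG)"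
    unfolding theta_def theta_density_def[symmetric]
    by (intro nn_integral_density) auto
  also have "\<dots> = (\<integral>\<^sup>+ r. ennreal (theta_density \<alpha> r) * g r * indicator posG r \<partial>lborel)"
    by (intro nn_integral_restrict_space) simp
  finally show ?thesis .
qed

lemma theta_density_pos: "\<alpha> \<in> posG \<Longrightarrow> r \<in> posG \<Longrightarrow> 0 < theta_density \<alpha> r"
  unfolding theta_density_def posG_def
  by (rule prod_pos) (simp add: less_imp_neq[THEN not_sym])

lemma theta_density_scale:
  assumes u: "u \<in> posG" and r: "r \<in> posG"
  shows "(\<Prod>i\<in>UNIV. u $ i) * theta_density \<alpha> (u * r) * chi \<alpha> u = theta_density \<alpha> r"
  unfolding theta_density_def chi_def prod.distrib[symmetric]
proof (intro prod.cong refl)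
  fix i
  have p: "0 < u $ i" "0 < r $ i"
    using u r by (auto simp: posG_def)
  have "u $ i * u $ i powr (- (\<alpha> $ i) - 1) * u $ i powr (\<alpha> $ i) = u $ i powr (1 + (- (\<alpha> $ i) - 1) + \<alpha> $ i)"
    using p by (simp only: powr_add) simp
  also have "\<dots> = 1" using p by simp
  finally show "u $ i * (\<alpha> $ i * (u * r) $ i powr (- \<alpha> $ i - 1)) * u $ i powr \<alpha> $ i = \<alpha> $ i * r $ i powr (- \<alpha> $ i - 1)"
    using p by (simp add: powr_mult mult_ac)
qed

text \<open>
  In the integral of \<open>g\<close>, substituting \<open>r u\<close> for \<open>r\<close> costs the Jacobian \<open>\<Prod> u\<^sub>i\<close>, while the density contributes
  \<open>\<Prod> u\<^sub>i powr (- \<alpha>\<^sub>i - 1)\<close>; what remains is \<open>1 / \<chi>(u)\<close>.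
\<close>

lemma nn_integral_theta_scale:
  fixes u :: "real ^ 'q"
  assumes u: "u \<in> posG" and g: "g \<in> borel_measurable (theta \<alpha>)"
  shows "(\<integral>\<^sup>+ r. g (r * u) \<partial>theta \<alpha>) = ennreal (chi \<alpha> u) * (\<integral>\<^sup>+ r. g r \<partial>theta \<alpha>)"
proof -
  note g[measurable]
  (* Lebesgue measure is rescaled on the whole space, where g itself need not be measurable. *)
  have g': "(\<lambda>r. ennreal (theta_density \<alpha> r) * g r * indicator posG r) \<in> borel_measurable borel"
  proof -
    have "(\<lambda>r. ennreal (theta_density \<alpha> r) * g r) \<in> borel_measurable (restrict_space borel posG)"
      using g by (intro borel_measurable_times_ennreal)
        (auto simp: measurable_cong_sets[OF sets_theta refl] measurable_restrict_space1)
    then show ?thesis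
      by (subst (asm) borel_measurable_restrict_space_iff_ennreal) auto
  qed
  have [measurable]: "(\<lambda>r. g (r * u)) \<in> borel_measurable (theta \<alpha>)"
  proof -
    have "(\<lambda>r. r * u) \<in> theta \<alpha> \<rightarrow>\<^sub>M theta \<alpha>"
      using u by (intro measurable_theta_mult) auto
    then show ?thesis
      by (rule measurable_compose) fact
  qed
  have [simp]: "u * r \<in> posG \<longleftrightarrow> r \<in> posG" for r
    using posG_mult_pos_iff[OF u] by (simp add: posG_def)
  have "ennreal (chi \<alpha> u) * (\<integral>\<^sup>+ r. g r \<partial>theta \<alpha>) =
      ennreal (chi \<alpha> u) * (ennreal (\<Prod>i\<in>UNIV. u $ i) *
        (\<integral>\<^sup>+ r. ennreal (theta_density \<alpha> (u * r)) * g (u * r) * indicator posG (u * r) \<partial>lborel))"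
    using nn_integral_lborel_diagonal[OF u g'] by (simp add: nn_integral_theta)
  also have "\<dots> = (\<integral>\<^sup>+ r. ennreal (chi \<alpha> u) * (ennreal (\<Prod>i\<in>UNIV. u $ i) *
        (ennreal (theta_density \<alpha> (u * r)) * g (u * r) * indicator posG (u * r))) \<partial>lborel)"
  proof -
    have "(\<lambda>x. u * x) \<in> borel_measurable borel"
      by (simp add: borel_measurable_vec_iff)
    from measurable_compose[OF this g']
    have m: "(\<lambda>r. ennreal (theta_density \<alpha> (u * r)) * g (u * r) * indicator posG (u * r)) \<in> borel_measurable lborel"
      by (simp only: measurable_cong_sets[OF sets_lborel refl])
    show ?thesis
      by (simp only: nn_integral_cmult[OF m]
          nn_integral_cmult[OF borel_measurable_times_ennreal[OF borel_measurable_const m]])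
  qed
  also have "\<dots> = (\<integral>\<^sup>+ r. ennreal (theta_density \<alpha> r) * g (r * u) * indicator posG r \<partial>lborel)"
  proof (intro nn_integral_cong)
    fix r :: "real ^ 'q"
    show "ennreal (chi \<alpha> u) * (ennreal (\<Prod>i\<in>UNIV. u $ i) *
        (ennreal (theta_density \<alpha> (u * r)) * g (u * r) * indicator posG (u * r))) =
        ennreal (theta_density \<alpha> r) * g (r * u) * indicator posG r"
    proof (cases "r \<in> posG")
      case True
      have "0 \<le> (\<Prod>i\<in>UNIV. u $ i)"
        using u by (auto simp: posG_def less_imp_le intro!: prod_nonneg)
      then have "ennreal (theta_density \<alpha> r) =
          ennreal (chi \<alpha> u) * (ennreal (\<Prod>i\<in>UNIV. u $ i) * ennreal (theta_density \<alpha> (u * r)))"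
        using chi_pos[OF u, of \<alpha>]
        by (simp add: theta_density_scale[OF u True, of \<alpha>, symmetric] mult_ac flip: ennreal_mult')
      then show ?thesis
        using True u by (simp add: mult_ac)
    qed simp
  qed
  also have "\<dots> = (\<integral>\<^sup>+ r. g (r * u) \<partial>theta \<alpha>)"
    by (simp add: nn_integral_theta)
  finally show ?thesis by simp
qed

lemma AE_theta_imp_ex:
  assumes "\<alpha> \<in> posG" and "AE r in theta (\<alpha> :: real ^ 'q). P r"
  shows "\<exists>r\<in>posG. P r"
proof (rule ccontr)
  assume n: "\<not> ?thesis"
  have "AE r in lborel. r \<in> posG \<longrightarrow> 0 < theta_density \<alpha> r \<longrightarrow> P r"
    using assms(2) unfolding theta_def theta_density_def[symmetric]
    by (subst (asm) AE_density)
      (auto simp: AE_restrict_space_iff measurable_restrict_space1)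
  then have "AE r in lborel. r \<notin> (posG :: (real ^ 'q) set)"
    by eventually_elim (use n theta_density_pos[OF assms(1)] in auto)
  then have "(posG :: (real ^ 'q) set) \<in> null_sets lborel"
    by (subst (asm) AE_iff_null_sets[symmetric]) auto
  then have "negligible (posG :: (real ^ 'q) set)"
    by (simp add: negligible_iff_null_sets null_sets_completionI)
  then show False
    using open_not_negligible[OF open_posG] one_posG by blast
qed

lemma nn_integral_theta_pos:
  assumes "\<alpha> \<in> posG" and [measurable]: "g \<in> borel_measurable (theta \<alpha>)"
    and "\<And>r. r \<in> posG \<Longrightarrow> 0 < g r"
  shows "0 < (\<integral>\<^sup>+ r. g r \<partial>theta \<alpha>)"
proof (rule ccontr)
  assume "\<not> ?thesis"
  then have "AE r in theta \<alpha>. g r = 0"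
    by (simp add: nn_integral_0_iff_AE)
  from AE_theta_imp_ex[OF assms(1) this] show False
    using assms(3) by fastforce
qed

lemma sigma_finite_positive_integrable_exists:
  assumes "sigma_finite_measure N"
  shows "\<exists>p :: 'b \<Rightarrow> real. p \<in> borel_measurable N \<and> (\<forall>x. 0 < p x) \<and> (\<integral>\<^sup>+ x. ennreal (p x) \<partial>N) < \<infinity>"
proof -
  interpret sigma_finite_measure N by fact
  show ?thesis
  proof (rule obtain_positive_integrable_function)
    fix p :: "'b \<Rightarrow> real"
    assume p: "p \<in> borel_measurable N" "\<And>x. 0 < p x" "integrable N p"
    have "(\<integral>\<^sup>+ x. ennreal (p x) \<partial>N) = (\<integral>\<^sup>+ x. ennreal (norm (p x)) \<partial>N)"
      using p(2) by (simp add: less_imp_le)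
    also have "\<dots> < \<infinity>"
      using p(3) by (simp add: integrable_iff_bounded)
    finally show ?thesis using p(1,2) by (intro exI[of _ p] conjI allI)
  qed
qed

text \<open>
  The factor \<open>\<chi>(u)\<close> of \<open>nn_integral_theta_scale\<close> cancels against the multiplicative weight
  \<open>\<chi>(r)\<close>, so \<open>\<chi> \<theta>\<close> is a Haar measure.
\<close>

lemma haar_scale:
  assumes u: "u \<in> posG" and g[measurable]: "g \<in> borel_measurable (theta \<alpha>)"
  shows "(\<integral>\<^sup>+ r. g (r * u) * ennreal (chi \<alpha> r) \<partial>theta \<alpha>) = (\<integral>\<^sup>+ r. g r * ennreal (chi \<alpha> r) \<partial>theta \<alpha>)"
proof -
  have [measurable]: "(\<lambda>r. g (r * u)) \<in> borel_measurable (theta \<alpha>)"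
    using u by (intro measurable_compose[OF _ g] measurable_theta_mult) auto
  have "(\<integral>\<^sup>+ r. g (r * u) * ennreal (chi \<alpha> r) \<partial>theta \<alpha>) =
     (\<integral>\<^sup>+ r. ennreal (chi \<alpha> (vinv u)) * (g (r * u) * ennreal (chi \<alpha> (r * u))) \<partial>theta \<alpha>)"
  proof (intro nn_integral_cong)
    fix r assume "r \<in> space (theta \<alpha>)"
    then have r: "r \<in> posG" by simp
    have "chi \<alpha> r = chi \<alpha> (vinv u) * chi \<alpha> (r * u)"
      using chi_pos[OF u, of \<alpha>] by (simp add: chi_mult[OF r u] chi_vinv[OF u])
    then have "ennreal (chi \<alpha> r) = ennreal (chi \<alpha> (vinv u)) * ennreal (chi \<alpha> (r * u))"
      using u r chi_pos[of "vinv u" \<alpha>] by (simp add: ennreal_mult')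
    then show "g (r * u) * ennreal (chi \<alpha> r) =
        ennreal (chi \<alpha> (vinv u)) * (g (r * u) * ennreal (chi \<alpha> (r * u)))"
      by (simp add: mult_ac)
  qed
  also have "\<dots> = ennreal (chi \<alpha> (vinv u)) * (\<integral>\<^sup>+ r. g (r * u) * ennreal (chi \<alpha> (r * u)) \<partial>theta \<alpha>)"
    using u by (intro nn_integral_cmult borel_measurable_times_ennreal) (auto intro!: measurable_chi measurable_theta_mult measurable_compose[OF _ measurable_ennreal])
  also have "\<dots> = ennreal (chi \<alpha> (vinv u)) * (ennreal (chi \<alpha> u) * (\<integral>\<^sup>+ r. g r * ennreal (chi \<alpha> r) \<partial>theta \<alpha>))"
    using nn_integral_theta_scale[OF u, of "\<lambda>r. g r * ennreal (chi \<alpha> r)"] by simp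
  also have "\<dots> = (\<integral>\<^sup>+ r. g r * ennreal (chi \<alpha> r) \<partial>theta \<alpha>)"
    using chi_pos[OF u, of \<alpha>] u
    by (simp add: mult.assoc[symmetric] chi_vinv flip: ennreal_mult')
  finally show ?thesis .
qed

text \<open>
  Inversion invariance follows from translation invariance by Fubini, as in the uniqueness proof for
  Haar measures.  With \<open>H = \<chi> \<theta>\<close> and a function \<open>h\<close> whose integral is positive and finite, translate
  first in \<open>r\<close>, then in \<open>s\<close>, then again in \<open>r\<close>:
  \<open>\<integral>\<integral> h(r) g(s\<^sup>-\<^sup>1) = \<integral>\<integral> h(r s) g(s\<^sup>-\<^sup>1) = \<integral>\<integral> h(s) g(r s\<^sup>-\<^sup>1) = \<integral>\<integral> h(s) g(r)\<close>,
  all integrals being with respect to \<open>H \<otimes> H\<close>.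
\<close>

lemma haar_vinv:
  assumes \<alpha>: "\<alpha> \<in> posG" and g[measurable]: "g \<in> borel_measurable (theta \<alpha>)"
  shows "(\<integral>\<^sup>+ r. g (vinv r) * ennreal (chi \<alpha> r) \<partial>theta \<alpha>) = (\<integral>\<^sup>+ r. g r * ennreal (chi \<alpha> r) \<partial>theta \<alpha>)"
proof -
  interpret \<theta>: sigma_finite_measure "theta \<alpha>" by (rule sigma_finite_theta)
  interpret \<theta>\<theta>: pair_sigma_finite "theta \<alpha>" "theta \<alpha>" ..
  obtain p where p[measurable]: "p \<in> borel_measurable (theta \<alpha>)" and p0: "\<forall>r. 0 < p r"
    and pfin: "(\<integral>\<^sup>+ r. ennreal (p r) \<partial>theta \<alpha>) < \<infinity>"
    using sigma_finite_positive_integrable_exists[OF sigma_finite_theta, of \<alpha>] by (elim exE conjE)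
  define h where "h r = ennreal (p r / chi \<alpha> r)" for r
  have [measurable]: "h \<in> borel_measurable (theta \<alpha>)"
    unfolding h_def by measurable
  have mh[measurable (raw)]: "(\<lambda>x. h (f x)) \<in> borel_measurable N" if "f \<in> N \<rightarrow>\<^sub>M theta \<alpha>" for f and N :: "'c measure"
    using that by (rule measurable_compose) measurable
  have mg[measurable (raw)]: "(\<lambda>x. g (f x)) \<in> borel_measurable N" if "f \<in> N \<rightarrow>\<^sub>M theta \<alpha>" for f and N :: "'c measure"
    using that by (rule measurable_compose) measurable
  define c where "c = (\<integral>\<^sup>+ r. h r * ennreal (chi \<alpha> r) \<partial>theta \<alpha>)"
  have "c = (\<integral>\<^sup>+ r. ennreal (p r) \<partial>theta \<alpha>)"
    unfolding c_def
  proof (intro nn_integral_cong)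
    fix r assume "r \<in> space (theta \<alpha>)"
    with chi_pos[of r \<alpha>] p0[rule_format, of r] show "h r * ennreal (chi \<alpha> r) = ennreal (p r)"
      by (simp add: h_def flip: ennreal_mult)
  qed
  with pfin nn_integral_theta_pos[OF \<alpha>, of "\<lambda>r. ennreal (p r)"] p0 have "0 < c" "c < \<infinity>"
    by auto
  then have c: "c \<noteq> 0" "c \<noteq> top"
    by auto
  have cancel: "a = b" if "c * a = c * b" for a b :: ennreal
    using that c by (simp add: ennreal_mult_cancel_left)
  let ?X = "\<lambda>r. ennreal (chi \<alpha> r)"
  have "c * (\<integral>\<^sup>+ s. g (vinv s) * ?X s \<partial>theta \<alpha>) = (\<integral>\<^sup>+ s. (\<integral>\<^sup>+ r. h r * ?X r \<partial>theta \<alpha>) * (g (vinv s) * ?X s) \<partial>theta \<alpha>)"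
    unfolding c_def by (subst nn_integral_cmult) auto
  also have "\<dots> = (\<integral>\<^sup>+ s. (\<integral>\<^sup>+ r. h (r * s) * ?X r \<partial>theta \<alpha>) * (g (vinv s) * ?X s) \<partial>theta \<alpha>)"
    by (intro nn_integral_cong) (subst haar_scale, auto)
  also have "\<dots> = (\<integral>\<^sup>+ s. (\<integral>\<^sup>+ r. h (r * s) * ?X r * (g (vinv s) * ?X s) \<partial>theta \<alpha>) \<partial>theta \<alpha>)"
    by (intro nn_integral_cong nn_integral_multc[symmetric]) measurable
  also have "\<dots> = (\<integral>\<^sup>+ r. (\<integral>\<^sup>+ s. h (r * s) * ?X r * (g (vinv s) * ?X s) \<partial>theta \<alpha>) \<partial>theta \<alpha>)"
    by (rule \<theta>\<theta>.Fubini') measurable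
  also have "\<dots> = (\<integral>\<^sup>+ r. ?X r * (\<integral>\<^sup>+ s. (h (s * r) * g (r * vinv (s * r))) * ?X s \<partial>theta \<alpha>) \<partial>theta \<alpha>)"
  proof (intro nn_integral_cong)
    fix r assume "r \<in> space (theta \<alpha>)"
    then have [measurable]: "(\<lambda>_. r) \<in> N \<rightarrow>\<^sub>M theta \<alpha>" for N :: "'c measure" by simp
    have "(\<integral>\<^sup>+ s. h (r * s) * ?X r * (g (vinv s) * ?X s) \<partial>theta \<alpha>) =
      (\<integral>\<^sup>+ s. ?X r * ((h (s * r) * g (r * vinv (s * r))) * ?X s) \<partial>theta \<alpha>)"
    proof (intro nn_integral_cong)
      fix s assume "s \<in> space (theta \<alpha>)"
      have "r * vinv (s * r) = vinv s"
        using \<open>r \<in> space (theta \<alpha>)\<close> by (auto simp: vec_eq_iff vinv_def posG_def less_le)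
      then show "h (r * s) * ?X r * (g (vinv s) * ?X s) = ?X r * ((h (s * r) * g (r * vinv (s * r))) * ?X s)"
        by (simp add: mult_ac)
    qed
    also have "\<dots> = ?X r * (\<integral>\<^sup>+ s. (h (s * r) * g (r * vinv (s * r))) * ?X s \<partial>theta \<alpha>)"
      by (intro nn_integral_cmult) measurable
    finally show "(\<integral>\<^sup>+ s. h (r * s) * ?X r * (g (vinv s) * ?X s) \<partial>theta \<alpha>) = \<dots>" .
  qed
  also have "\<dots> = (\<integral>\<^sup>+ r. ?X r * (\<integral>\<^sup>+ s. (h s * g (r * vinv s)) * ?X s \<partial>theta \<alpha>) \<partial>theta \<alpha>)"
  proof (intro nn_integral_cong)
    fix r assume "r \<in> space (theta \<alpha>)"
    then have r: "r \<in> posG" and [measurable]: "(\<lambda>_. r) \<in> N \<rightarrow>\<^sub>M theta \<alpha>" for N :: "'c measure" by simp_all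
    show "?X r * (\<integral>\<^sup>+ s. (h (s * r) * g (r * vinv (s * r))) * ?X s \<partial>theta \<alpha>) = 
      ?X r * (\<integral>\<^sup>+ s. (h s * g (r * vinv s)) * ?X s \<partial>theta \<alpha>)"
      using haar_scale[OF r, of "\<lambda>s. h s * g (r * vinv s)"] by simp
  qed
  also have "\<dots> = (\<integral>\<^sup>+ r. (\<integral>\<^sup>+ s. ?X r * (h s * g (r * vinv s) * ?X s) \<partial>theta \<alpha>) \<partial>theta \<alpha>)"
    by (intro nn_integral_cong nn_integral_cmult[symmetric])
      (auto intro!: mg mh borel_measurable_times_ennreal measurable_theta_mult measurable_theta_vinv measurable_compose[OF _ measurable_ennreal] measurable_chi)
  also have "\<dots> = (\<integral>\<^sup>+ s. (\<integral>\<^sup>+ r. ?X r * (h s * g (r * vinv s) * ?X s) \<partial>theta \<alpha>) \<partial>theta \<alpha>)"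
    by (rule \<theta>\<theta>.Fubini') measurable
  also have "\<dots> = (\<integral>\<^sup>+ s. (h s * ?X s) * (\<integral>\<^sup>+ r. g (r * vinv s) * ?X r \<partial>theta \<alpha>) \<partial>theta \<alpha>)"
  proof (intro nn_integral_cong)
    fix s assume "s \<in> space (theta \<alpha>)"
    then have [measurable]: "(\<lambda>_. s) \<in> N \<rightarrow>\<^sub>M theta \<alpha>" for N :: "'c measure" by simp
    show "(\<integral>\<^sup>+ r. ?X r * (h s * g (r * vinv s) * ?X s) \<partial>theta \<alpha>) = (h s * ?X s) * (\<integral>\<^sup>+ r. g (r * vinv s) * ?X r \<partial>theta \<alpha>)"
      by (subst nn_integral_cmult[symmetric]) (measurable, simp add: mult_ac)
  qed
  also have "\<dots> = (\<integral>\<^sup>+ s. (h s * ?X s) * (\<integral>\<^sup>+ r. g r * ?X r \<partial>theta \<alpha>) \<partial>theta \<alpha>)"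
    by (intro nn_integral_cong) (subst haar_scale, auto)
  also have "\<dots> = c * (\<integral>\<^sup>+ r. g r * ?X r \<partial>theta \<alpha>)"
    unfolding c_def by (intro nn_integral_multc) measurable
  finally show ?thesis
    by (rule cancel)
qed

section \<open>The action\<close>

locale homogeneous_action =
  fixes M :: "'a measure" and S :: "real ^ 'q \<Rightarrow> 'a \<Rightarrow> 'a" and \<alpha> :: "real ^ 'q"
  assumes action: "action M S" and \<alpha>: "\<alpha> \<in> posG"
begin

interpretation \<theta>: sigma_finite_measure "theta \<alpha>" by (rule sigma_finite_theta)

lemma measurable_action[measurable (raw)]:
  assumes f: "f \<in> N \<rightarrow>\<^sub>M theta \<alpha>" and g: "g \<in> N \<rightarrow>\<^sub>M M"
  shows "(\<lambda>x. S (f x) (g x)) \<in> N \<rightarrow>\<^sub>M M"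
proof -
  have "(\<lambda>(r, x). S r x) \<in> theta \<alpha> \<Otimes>\<^sub>M M \<rightarrow>\<^sub>M M"
    using action unfolding action_def
    by (simp add: measurable_cong_sets[OF sets_pair_measure_cong[OF sets_theta refl] refl])
  from measurable_compose[OF measurable_Pair[OF f g] this] show ?thesis by simp
qed

lemma action_one: "x \<in> space M \<Longrightarrow> S 1 x = x"
  and action_mult: "r \<in> posG \<Longrightarrow> s \<in> posG \<Longrightarrow> x \<in> space M \<Longrightarrow> S r (S s x) = S (r * s) x"
  using action by (auto simp: action_def)

lemma action_space[simp]:
  assumes "r \<in> posG" "x \<in> space M" shows "S r x \<in> space M"
proof -
  have "(\<lambda>x. S r x) \<in> M \<rightarrow>\<^sub>M M"
    using assms(1) by (intro measurable_action) auto
  with assms(2) show ?thesis by (rule measurable_space[rotated])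
qed

lemma action_vinv:
  assumes "r \<in> posG" "x \<in> space M"
  shows "S r (S (vinv r) x) = x" "S (vinv r) (S r x) = x"
  using assms by (simp_all add: action_mult vinv_mult action_one)

lemma measurable_orbit:
  assumes g: "g \<in> borel_measurable M" and x: "x \<in> space M"
  shows "(\<lambda>r. g (S r x)) \<in> borel_measurable (theta \<alpha>)"
  using x by (intro measurable_compose[OF _ g] measurable_action) auto

lemma orbit_integral_action:
  assumes g: "g \<in> borel_measurable M" and x: "x \<in> space M" and u: "u \<in> posG"
  shows "(\<integral>\<^sup>+ r. g (S r (S u x)) \<partial>theta \<alpha>) = ennreal (chi \<alpha> u) * (\<integral>\<^sup>+ r. g (S r x) \<partial>theta \<alpha>)"
proof -
  have "(\<integral>\<^sup>+ r. g (S r (S u x)) \<partial>theta \<alpha>) = (\<integral>\<^sup>+ r. g (S (r * u) x) \<partial>theta \<alpha>)"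
    using x u by (intro nn_integral_cong) (simp add: action_mult)
  also have "\<dots> = ennreal (chi \<alpha> u) * (\<integral>\<^sup>+ r. g (S r x) \<partial>theta \<alpha>)"
    using nn_integral_theta_scale[OF u measurable_orbit[OF g x]] .
  finally show ?thesis .
qed

lemma K_action:
  assumes [measurable]: "f \<in> borel_measurable M" and "x \<in> space M" "u \<in> posG"
  shows "K \<alpha> S f (S u x) = ennreal (chi \<alpha> u) * K \<alpha> S f x"
  unfolding K_def using assms(2,3) by (intro orbit_integral_action[where g = "\<lambda>x. ennreal (f x)"]) auto

lemma K_measurable[measurable]:
  assumes f: "f \<in> borel_measurable M"
  shows "K \<alpha> S f \<in> borel_measurable M"
proof -
  note measurable_compose[OF _ f, measurable (raw)]
  show ?thesis unfolding K_def by measurable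
qed

lemma K_pos:
  assumes f: "f \<in> borel_measurable M" "\<And>x. x \<in> space M \<Longrightarrow> 0 < f x" and x: "x \<in> space M"
  shows "0 < K \<alpha> S f x"
  unfolding K_def
  using f(2) x measurable_orbit[OF f(1) x] by (intro nn_integral_theta_pos[OF \<alpha>]) auto

lemma K_finite_action:
  assumes f: "f \<in> borel_measurable M" and x: "x \<in> space M" and u: "u \<in> posG"
  shows "K \<alpha> S f (S u x) < top \<longleftrightarrow> K \<alpha> S f x < top" "0 < K \<alpha> S f (S u x) \<longleftrightarrow> 0 < K \<alpha> S f x"
  using chi_pos[OF u, of \<alpha>] K_action[OF assms]
  by (auto simp: ennreal_mult_less_top ennreal_zero_less_mult_iff)

section \<open>From random elements to finite orbit integrals\<close>

text \<open>
  The representation identifies \<open>\<nu>\<close> with the image of \<open>P \<otimes> \<theta>\<close> under \<open>(\<omega>, r) \<mapsto> S\<^sub>r (Z \<omega>)\<close>.  Thus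
  \<open>\<integral> f d\<nu>\<close> is the expectation of \<open>K\<^sub>f Z\<close>, and since finiteness of \<open>K\<^sub>f\<close> does not change along
  orbits, it passes from \<open>Z\<close> to \<open>\<nu>\<close>-almost every point.
\<close>

lemma K_finite_of_random_element:
  assumes sets: "sets \<nu> = sets M" and "sigma_finite_measure P" and P: "Z \<in> P \<rightarrow>\<^sub>M M"
    and \<nu>: "\<And>A. A \<in> sets M \<Longrightarrow> emeasure \<nu> A = nu_of \<alpha> S P Z A"
    and f: "f \<in> borel_measurable M" and int: "(\<integral>\<^sup>+ x. ennreal (f x) \<partial>\<nu>) < \<infinity>"
  shows "AE x in \<nu>. K \<alpha> S f x < \<infinity>"
proof -
  interpret P: sigma_finite_measure P by fact
  interpret P\<theta>: pair_sigma_finite P "theta \<alpha>" ..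
  note P[measurable] f[measurable]
  let ?T = "\<lambda>p. S (snd p) (Z (fst p))"
  have T[measurable]: "?T \<in> P \<Otimes>\<^sub>M theta \<alpha> \<rightarrow>\<^sub>M M" by measurable
  have \<nu>_distr: "\<nu> = distr (P \<Otimes>\<^sub>M theta \<alpha>) M ?T"
  proof (rule measure_eqI)
    fix A assume "A \<in> sets \<nu>"
    then have [measurable]: "A \<in> sets M" by (simp add: sets)
    have "emeasure (distr (P \<Otimes>\<^sub>M theta \<alpha>) M ?T) A = (\<integral>\<^sup>+ p. indicator A (?T p) \<partial>(P \<Otimes>\<^sub>M theta \<alpha>))"
      by (simp add: nn_integral_distr flip: nn_integral_indicator)
    also have "\<dots> = nu_of \<alpha> S P Z A"
      unfolding nu_of_def by (subst \<theta>.nn_integral_fst[symmetric]) auto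
    finally show "emeasure \<nu> A = emeasure (distr (P \<Otimes>\<^sub>M theta \<alpha>) M ?T) A"
      by (simp add: \<nu>)
  qed (simp add: sets)
  have "(\<integral>\<^sup>+ x. ennreal (f x) \<partial>\<nu>) = (\<integral>\<^sup>+ p. ennreal (f (?T p)) \<partial>(P \<Otimes>\<^sub>M theta \<alpha>))"
    unfolding \<nu>_distr by (subst nn_integral_distr) auto
  also have "\<dots> = (\<integral>\<^sup>+ \<omega>. K \<alpha> S f (Z \<omega>) \<partial>P)"
    unfolding K_def by (subst \<theta>.nn_integral_fst[symmetric]) auto
  finally have "AE \<omega> in P. K \<alpha> S f (Z \<omega>) \<noteq> \<infinity>"
    using int by (intro nn_integral_PInf_AE) (auto intro!: measurable_compose[OF P K_measurable])
  then have "AE \<omega> in P. AE r in theta \<alpha>. K \<alpha> S f (?T (\<omega>, r)) < \<infinity>"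
    using AE_space
    by eventually_elim
      (auto intro!: AE_I2 simp: K_finite_action f measurable_space[OF P] less_top)
  then have "AE p in P \<Otimes>\<^sub>M theta \<alpha>. K \<alpha> S f (?T p) < \<infinity>"
    by (intro P\<theta>.AE_pair_measure) auto
  then show ?thesis
    unfolding \<nu>_distr by (subst AE_distr_iff) auto
qed

section \<open>From finite orbit integrals to random elements\<close>

text \<open>
  The preimage of a set under \<open>S\<^sub>u\<close> is its image under \<open>S\<^sub>v\<close>, where \<open>v = vinv u\<close>, so
  homogeneity, which speaks of images, determines the image measure of \<open>\<nu>\<close> under \<open>S\<^sub>u\<close>.
\<close>

lemma nn_integral_homogeneous:
  assumes sets: "sets \<nu> = sets M" and hom: "homogeneous \<alpha> M S \<nu>"
    and u: "u \<in> posG" and g: "g \<in> borel_measurable M"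
  shows "(\<integral>\<^sup>+ x. g (S u x) \<partial>\<nu>) = ennreal (chi \<alpha> u) * (\<integral>\<^sup>+ x. g x \<partial>\<nu>)"
proof -
  have sp: "space \<nu> = space M" using sets by (rule sets_eq_imp_space_eq)
  have m: "S u \<in> \<nu> \<rightarrow>\<^sub>M M"
    using u unfolding measurable_cong_sets[OF sets refl] by (intro measurable_action) auto
  have "distr \<nu> M (S u) = scale_measure (ennreal (chi \<alpha> u)) \<nu>"
  proof (rule measure_eqI)
    fix A assume "A \<in> sets (distr \<nu> M (S u))"
    then have A: "A \<in> sets M" by simp
    have "S u -` A \<inter> space \<nu> = S (vinv u) ` A"
    proof (rule set_eqI, rule iffI)
      fix x assume "x \<in> S u -` A \<inter> space \<nu>"
      then show "x \<in> S (vinv u) ` A"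
        using action_vinv[OF u, of x] by (auto simp: sp intro!: image_eqI[of _ _ "S u x"])
    next
      fix x assume "x \<in> S (vinv u) ` A"
      then obtain y where "y \<in> A" "x = S (vinv u) y" by blast
      then show "x \<in> S u -` A \<inter> space \<nu>"
        using sets.sets_into_space[OF A] action_vinv(1)[OF u, of y] u by (auto simp: sp)
    qed
    then show "emeasure (distr \<nu> M (S u)) A = emeasure (scale_measure (ennreal (chi \<alpha> u)) \<nu>) A"
      using hom A u chi_pos[OF u, of \<alpha>] unfolding homogeneous_def
      by (simp add: emeasure_distr[OF m A] chi_vinv)
  qed (simp add: sets)
  then have "(\<integral>\<^sup>+ x. g x \<partial>distr \<nu> M (S u)) = ennreal (chi \<alpha> u) * (\<integral>\<^sup>+ x. g x \<partial>\<nu>)"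
    using g by (simp add: nn_integral_scale_measure measurable_cong_sets[OF sets refl])
  then show ?thesis
    using g by (subst (asm) nn_integral_distr[OF m]) auto
qed

text \<open>
  For fixed \<open>r\<close> the substitution \<open>y = S\<^sub>r x\<close> in the integral over \<open>\<nu>\<close> transfers the group element
  from \<open>g\<close> to \<open>w\<close> at the price \<open>\<chi>(r)\<close>; Fubini takes \<open>r\<close> outside and back.
\<close>

lemma homogeneous_exchange:
  assumes sets: "sets \<nu> = sets M" and hom: "homogeneous \<alpha> M S \<nu>" and sf: "sigma_finite_measure \<nu>"
    and g: "g \<in> borel_measurable M" and w: "w \<in> borel_measurable M"
  shows "(\<integral>\<^sup>+ x. w x * (\<integral>\<^sup>+ r. g (S r x) \<partial>theta \<alpha>) \<partial>\<nu>) =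
    (\<integral>\<^sup>+ y. g y * (\<integral>\<^sup>+ r. w (S (vinv r) y) * ennreal (chi \<alpha> r) \<partial>theta \<alpha>) \<partial>\<nu>)"
proof -
  interpret sigma_finite_measure \<nu> by fact
  interpret p: pair_sigma_finite \<nu> "theta \<alpha>" ..
  have sp: "space \<nu> = space M" using sets by (rule sets_eq_imp_space_eq)
  note sets[measurable_cong]
  note measurable_compose[OF _ g, measurable (raw)] measurable_compose[OF _ w, measurable (raw)]
  have "(\<integral>\<^sup>+ x. w x * (\<integral>\<^sup>+ r. g (S r x) \<partial>theta \<alpha>) \<partial>\<nu>) =
      (\<integral>\<^sup>+ x. (\<integral>\<^sup>+ r. w x * g (S r x) \<partial>theta \<alpha>) \<partial>\<nu>)"
    using measurable_orbit[OF g] by (intro nn_integral_cong nn_integral_cmult[symmetric]) (simp add: sp)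
  also have "\<dots> = (\<integral>\<^sup>+ r. (\<integral>\<^sup>+ x. w x * g (S r x) \<partial>\<nu>) \<partial>theta \<alpha>)"
    by (rule p.Fubini'[symmetric]) measurable
  also have "\<dots> = (\<integral>\<^sup>+ r. (\<integral>\<^sup>+ x. ennreal (chi \<alpha> r) * (w (S (vinv r) x) * g x) \<partial>\<nu>) \<partial>theta \<alpha>)"
  proof (rule nn_integral_cong)
    fix r assume "r \<in> space (theta \<alpha>)"
    then have r: "r \<in> posG" and [measurable]: "(\<lambda>_. r) \<in> N \<rightarrow>\<^sub>M theta \<alpha>" for N :: "'a measure"
      by simp_all
    have "(\<integral>\<^sup>+ x. w x * g (S r x) \<partial>\<nu>) = (\<integral>\<^sup>+ x. w (S (vinv r) (S r x)) * g (S r x) \<partial>\<nu>)"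
      using r by (intro nn_integral_cong) (simp add: sp action_vinv)
    also have "\<dots> = ennreal (chi \<alpha> r) * (\<integral>\<^sup>+ x. w (S (vinv r) x) * g x \<partial>\<nu>)"
      by (rule nn_integral_homogeneous[OF sets hom r]) measurable
    also have "\<dots> = (\<integral>\<^sup>+ x. ennreal (chi \<alpha> r) * (w (S (vinv r) x) * g x) \<partial>\<nu>)"
      by (intro nn_integral_cmult[symmetric]) measurable
    finally show "(\<integral>\<^sup>+ x. w x * g (S r x) \<partial>\<nu>) = \<dots>" .
  qed
  also have "\<dots> = (\<integral>\<^sup>+ x. (\<integral>\<^sup>+ r. ennreal (chi \<alpha> r) * (w (S (vinv r) x) * g x) \<partial>theta \<alpha>) \<partial>\<nu>)"
    by (rule p.Fubini') measurable
  also have "\<dots> = (\<integral>\<^sup>+ y. g y * (\<integral>\<^sup>+ r. w (S (vinv r) y) * ennreal (chi \<alpha> r) \<partial>theta \<alpha>) \<partial>\<nu>)"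
  proof (rule nn_integral_cong)
    fix y assume "y \<in> space \<nu>"
    then have [measurable]: "(\<lambda>_. y) \<in> N \<rightarrow>\<^sub>M M" for N :: "(real ^ 'q) measure"
      by (simp add: sp)
    show "(\<integral>\<^sup>+ r. ennreal (chi \<alpha> r) * (w (S (vinv r) y) * g y) \<partial>theta \<alpha>) =
        g y * (\<integral>\<^sup>+ r. w (S (vinv r) y) * ennreal (chi \<alpha> r) \<partial>theta \<alpha>)"
      by (subst nn_integral_cmult[symmetric]) (measurable, simp add: mult_ac)
  qed
  finally show ?thesis .
qed

text \<open>
  After inverting \<open>r\<close> by \<open>haar_vinv\<close>, the denominator becomes \<open>K\<^sub>f (S\<^sub>r y) = \<chi>(r) K\<^sub>f y\<close>, whose
  factor \<open>\<chi>(r)\<close> turns the Haar measure back into \<open>\<theta>\<close>.  The integral is then \<open>K\<^sub>f y / K\<^sub>f y\<close>.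
\<close>

lemma normalised_orbit_integral:
  assumes f: "f \<in> borel_measurable M" and y: "y \<in> space M"
    and K: "0 < K \<alpha> S f y" "K \<alpha> S f y < \<infinity>"
  shows "(\<integral>\<^sup>+ r. ennreal (f (S (vinv r) y)) / K \<alpha> S f (S (vinv r) y) * ennreal (chi \<alpha> r) \<partial>theta \<alpha>) = 1"
proof -
  define w where "w x = ennreal (f x) / K \<alpha> S f x" for x
  have w[measurable]: "w \<in> borel_measurable M"
    using f unfolding w_def by measurable
  have "(\<integral>\<^sup>+ r. w (S (vinv r) y) * ennreal (chi \<alpha> r) \<partial>theta \<alpha>) = (\<integral>\<^sup>+ r. w (S r y) * ennreal (chi \<alpha> r) \<partial>theta \<alpha>)"
    by (rule haar_vinv[OF \<alpha> measurable_orbit[OF w y]])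
  also have "\<dots> = (\<integral>\<^sup>+ r. ennreal (f (S r y)) / K \<alpha> S f y \<partial>theta \<alpha>)"
  proof (rule nn_integral_cong)
    fix r assume "r \<in> space (theta \<alpha>)"
    then have r: "r \<in> posG" by simp
    obtain k where k: "K \<alpha> S f y = ennreal k" "0 < k"
      using K by (cases "K \<alpha> S f y") auto
    show "w (S r y) * ennreal (chi \<alpha> r) = ennreal (f (S r y)) / K \<alpha> S f y"
    proof (cases "0 \<le> f (S r y)")
      case True
      with k chi_pos[OF r, of \<alpha>] show ?thesis
        by (simp add: w_def K_action[OF f y r] divide_ennreal flip: ennreal_mult)
    qed (simp add: w_def ennreal_neg)
  qed
  also have "\<dots> = K \<alpha> S f y / K \<alpha> S f y"
    unfolding K_def using measurable_orbit[OF f y] by (intro nn_integral_divide) auto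
  also have "\<dots> = 1"
    using K by (simp add: ennreal_divide_self)
  finally show ?thesis unfolding w_def .
qed

text \<open>
  An explicit right inverse of \<open>\<chi>\<close>, measurable in \<open>k\<close>: each of the \<open>q\<close> coordinates contributes the
  factor \<open>k powr (1 / q)\<close>.
\<close>

lemma chi_section:
  assumes "0 < k"
  shows "(\<chi> i. k powr (1 / (real CARD('q) * \<alpha> $ i))) \<in> posG"
    and "chi \<alpha> (\<chi> i. k powr (1 / (real CARD('q) * \<alpha> $ i))) = k"
proof -
  show "(\<chi> i. k powr (1 / (real CARD('q) * \<alpha> $ i))) \<in> posG"
    using assms by (simp add: posG_def)
  have "chi \<alpha> (\<chi> i. k powr (1 / (real CARD('q) * \<alpha> $ i))) = (\<Prod>i\<in>(UNIV :: 'q set). k powr (1 / real CARD('q)))"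
    unfolding chi_def
  proof (intro prod.cong refl)
    fix i
    have "\<alpha> $ i \<noteq> 0" using \<alpha> by (simp add: posG_def less_imp_neq[THEN not_sym])
    then show "(\<chi> i. k powr (1 / (real CARD('q) * \<alpha> $ i))) $ i powr \<alpha> $ i = k powr (1 / real CARD('q))"
      by (simp add: powr_powr)
  qed
  also have "\<dots> = (k powr (1 / real CARD('q))) ^ CARD('q)"
    by simp
  also have "\<dots> = k"
    using assms by (simp add: powr_powr flip: powr_realpow)
  finally show "chi \<alpha> (\<chi> i. k powr (1 / (real CARD('q) * \<alpha> $ i))) = k" .
qed

text \<open>
  With \<open>C = \<integral> f d\<nu>\<close> take the law \<open>(f / C) \<nu>\<close> for the starting point \<open>x\<close> and move it by \<open>c(x)\<close> with
  \<open>\<chi>(c(x)) = C / K\<^sub>f x\<close>, which is to say, to a point where \<open>K\<^sub>f\<close> equals \<open>C\<close>.  The move converts the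
  density \<open>f / C\<close>, whose total mass is \<open>1\<close>, into the weight \<open>f / K\<^sub>f\<close>, whose orbit integrals are
  \<open>1\<close>; this is why a probability law suffices although \<open>(f / K\<^sub>f) \<nu>\<close> need not have mass \<open>1\<close>.
\<close>

lemma random_element_of_finite_K:
  assumes sets: "sets \<nu> = sets M" and hom: "homogeneous \<alpha> M S \<nu>" and sf: "sigma_finite_measure \<nu>"
    and f: "f \<in> borel_measurable M"
    and int: "0 < (\<integral>\<^sup>+ x. ennreal (f x) \<partial>\<nu>)" "(\<integral>\<^sup>+ x. ennreal (f x) \<partial>\<nu>) < \<infinity>"
    and K: "AE x in \<nu>. 0 < K \<alpha> S f x \<and> K \<alpha> S f x < \<infinity>"
  shows "\<exists>(P :: 'a measure) Z. prob_space P \<and> Z \<in> P \<rightarrow>\<^sub>M M \<and> (\<forall>A\<in>sets M. emeasure \<nu> A = nu_of \<alpha> S P Z A)"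
proof -
  have sp: "space \<nu> = space M" using sets by (rule sets_eq_imp_space_eq)
  note sets[measurable_cong] f[measurable]
  obtain C where C: "(\<integral>\<^sup>+ x. ennreal (f x) \<partial>\<nu>) = ennreal C" "0 < C"
    using int by (cases "(\<integral>\<^sup>+ x. ennreal (f x) \<partial>\<nu>)") auto
  (* The value 1 on the null set of bad points only keeps c inside the group. *)
  define k where "k x = (if 0 < K \<alpha> S f x \<and> K \<alpha> S f x < \<infinity> then C / enn2real (K \<alpha> S f x) else 1)" for x
  define c :: "'a \<Rightarrow> real ^ 'q" where "c x = (\<chi> i. k x powr (1 / (real CARD('q) * \<alpha> $ i)))" for x
  have k_pos: "0 < k x" for x
    using C by (auto simp: k_def enn2real_positive_iff)
  have k_meas[measurable]: "k \<in> borel_measurable M"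
    unfolding k_def by measurable
  have c_pos: "c x \<in> posG" and c_chi: "chi \<alpha> (c x) = k x" for x
    unfolding c_def using chi_section[OF k_pos] by auto
  have c_meas[measurable]: "c \<in> M \<rightarrow>\<^sub>M theta \<alpha>"
    by (intro measurable_thetaI c_pos) (simp add: c_def)
  define P where "P = density \<nu> (\<lambda>x. ennreal (f x / C))"
  define Z where "Z x = S (c x) x" for x
  have Z[measurable]: "Z \<in> M \<rightarrow>\<^sub>M M" unfolding Z_def by measurable
  have div: "ennreal (f x / C) = ennreal (f x) * ennreal (1 / C)" for x
    using C(2) by (cases "0 \<le> f x") (auto simp: ennreal_neg divide_nonpos_pos simp flip: ennreal_mult)
  have "prob_space P"
  proof (rule prob_spaceI)
    have "emeasure P (space P) = (\<integral>\<^sup>+ x. ennreal (f x) * ennreal (1 / C) \<partial>\<nu>)"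
      unfolding P_def div[symmetric] by (simp add: emeasure_density cong: nn_integral_cong)
    also have "\<dots> = 1"
      using C by (simp add: nn_integral_multc flip: ennreal_mult)
    finally show "emeasure P (space P) = 1" .
  qed
  moreover have "Z \<in> P \<rightarrow>\<^sub>M M"
    unfolding P_def by measurable
  moreover have "emeasure \<nu> A = nu_of \<alpha> S P Z A" if A[measurable]: "A \<in> sets M" for A
  proof -
    define w where "w x = ennreal (f x) / K \<alpha> S f x" for x
    have w[measurable]: "w \<in> borel_measurable M" unfolding w_def by measurable
    have iA: "(indicator A :: 'a \<Rightarrow> ennreal) \<in> borel_measurable M" by measurable
    have mI[measurable]: "(\<lambda>x. \<integral>\<^sup>+ r. indicator A (S r (Z x)) \<partial>theta \<alpha> :: ennreal) \<in> borel_measurable M"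
      by measurable
    have "nu_of \<alpha> S P Z A = (\<integral>\<^sup>+ x. ennreal (f x / C) * (\<integral>\<^sup>+ r. indicator A (S r (Z x)) \<partial>theta \<alpha>) \<partial>\<nu>)"
      unfolding nu_of_def P_def by (intro nn_integral_density) measurable
    also have "\<dots> = (\<integral>\<^sup>+ x. w x * (\<integral>\<^sup>+ r. indicator A (S r x) \<partial>theta \<alpha>) \<partial>\<nu>)"
    proof (intro nn_integral_cong_AE)
      show "AE x in \<nu>. ennreal (f x / C) * (\<integral>\<^sup>+ r. indicator A (S r (Z x)) \<partial>theta \<alpha>) =
          w x * (\<integral>\<^sup>+ r. indicator A (S r x) \<partial>theta \<alpha>)"
        using K AE_space
      proof eventually_elim
        case (elim x)
        then have x: "x \<in> space M" by (simp add: sp)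
        obtain l where l: "K \<alpha> S f x = ennreal l" "0 < l"
          using elim by (cases "K \<alpha> S f x") auto
        have kx: "k x = C / l"
          using l by (simp add: k_def)
        have "ennreal (f x / C) * ennreal (k x) = w x"
          using l C(2) by (cases "0 \<le> f x") (auto simp: kx w_def divide_ennreal ennreal_neg divide_nonpos_pos simp flip: ennreal_mult)
        then show ?case
          unfolding Z_def orbit_integral_action[OF iA x c_pos] c_chi by (simp add: mult.assoc[symmetric])
      qed
    qed
    also have "\<dots> = (\<integral>\<^sup>+ y. indicator A y * (\<integral>\<^sup>+ r. w (S (vinv r) y) * ennreal (chi \<alpha> r) \<partial>theta \<alpha>) \<partial>\<nu>)"
      by (rule homogeneous_exchange[OF sets hom sf iA w])
    also have "\<dots> = (\<integral>\<^sup>+ y. indicator A y \<partial>\<nu>)"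
    proof (intro nn_integral_cong_AE)
      show "AE y in \<nu>. indicator A y * (\<integral>\<^sup>+ r. w (S (vinv r) y) * ennreal (chi \<alpha> r) \<partial>theta \<alpha>) = indicator A y"
        using K AE_space by eventually_elim (simp add: w_def normalised_orbit_integral[OF f] sp)
    qed
    also have "\<dots> = emeasure \<nu> A" by simp
    finally show ?thesis by simp
  qed
  ultimately show ?thesis by blast
qed

section \<open>From gauges to finite orbit integrals\<close>

text \<open>
  On the orbit of a point where \<open>\<tau>\<close> is positive, the bound \<open>p \<circ> \<tau>\<close> on \<open>f\<close> is a translate of \<open>p\<close>,
  which makes \<open>K\<^sub>f\<close> finite by the scaling rule; the minimum with an integrable function keeps
  \<open>\<integral> f d\<nu>\<close> finite.
\<close>

lemma finite_K_of_gauge: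
  assumes sets: "sets \<nu> = sets M" and sf: "sigma_finite_measure \<nu>" and nz: "emeasure \<nu> (space M) \<noteq> 0"
    and \<tau>: "product_gauge M S \<tau>" "admissible \<nu> \<tau>"
  shows "\<exists>f :: 'a \<Rightarrow> real. f \<in> borel_measurable M \<and> (\<forall>x\<in>space M. 0 < f x) \<and>
          0 < (\<integral>\<^sup>+ x. ennreal (f x) \<partial>\<nu>) \<and> (\<integral>\<^sup>+ x. ennreal (f x) \<partial>\<nu>) < \<infinity> \<and>
          (AE x in \<nu>. 0 < K \<alpha> S f x \<and> K \<alpha> S f x < \<infinity>)"
proof -
  have sp: "space \<nu> = space M" using sets by (rule sets_eq_imp_space_eq)
  note sets[measurable_cong]
  obtain f0 :: "'a \<Rightarrow> real" where f0: "f0 \<in> borel_measurable \<nu>" "\<forall>x. 0 < f0 x"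
    "(\<integral>\<^sup>+ x. ennreal (f0 x) \<partial>\<nu>) < \<infinity>"
    using sigma_finite_positive_integrable_exists[OF sf] by (elim exE conjE)
  obtain p :: "real ^ 'q \<Rightarrow> real" where p: "p \<in> borel_measurable (theta \<alpha>)" "\<forall>r. 0 < p r"
    "(\<integral>\<^sup>+ r. ennreal (p r) \<partial>theta \<alpha>) < \<infinity>"
    using sigma_finite_positive_integrable_exists[OF sigma_finite_theta, of \<alpha>] by (elim exE conjE)
  have \<tau>_meas: "\<tau> \<in> borel_measurable M" and \<tau>_act: "\<And>r x. r \<in> posG \<Longrightarrow> x \<in> space M \<Longrightarrow> \<tau> (S r x) = r * \<tau> x"
    using \<tau>(1) by (auto simp: product_gauge_def)
  (* Off the set where all coordinates are positive, any value in the group keeps f positive. *)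
  define \<sigma> where "\<sigma> x = (if \<tau> x \<in> posG then \<tau> x else 1)" for x
  define f where "f x = min (f0 x) (p (\<sigma> x))" for x
  have "\<sigma> \<in> M \<rightarrow>\<^sub>M theta \<alpha>"
    using \<tau>_meas unfolding \<sigma>_def by (intro measurable_thetaI) (auto intro!: measurable_vec_nth)
  from measurable_compose[OF this p(1)] have f_meas[measurable]: "f \<in> borel_measurable M"
    using f0(1) unfolding f_def by (auto simp: measurable_cong_sets[OF sets refl])
  have f_pos: "0 < f x" for x
    using f0(2) p(2) by (simp add: f_def)
  have "(\<integral>\<^sup>+ x. ennreal (f x) \<partial>\<nu>) \<le> (\<integral>\<^sup>+ x. ennreal (f0 x) \<partial>\<nu>)"
    by (intro nn_integral_mono) (simp add: f_def ennreal_leI)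
  also have "\<dots> < \<infinity>"
    by (rule f0(3))
  finally have fin: "(\<integral>\<^sup>+ x. ennreal (f x) \<partial>\<nu>) < \<infinity>" .
  have "(\<integral>\<^sup>+ x. ennreal (f x) \<partial>\<nu>) \<noteq> 0"
  proof
    assume "(\<integral>\<^sup>+ x. ennreal (f x) \<partial>\<nu>) = 0"
    then have "AE x in \<nu>. ennreal (f x) = 0"
      by (subst (asm) nn_integral_0_iff_AE) auto
    then have "AE x in \<nu>. False"
      by eventually_elim (metis f_pos ennreal_eq_0_iff not_le)
    with nz show False
      using emeasure_eq_0_AE[of "\<lambda>_. True" \<nu>] by (simp add: sp)
  qed
  then have pos: "0 < (\<integral>\<^sup>+ x. ennreal (f x) \<partial>\<nu>)" by (simp add: zero_less_iff_neq_zero)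
  have "AE x in \<nu>. x \<in> (\<Inter>i. {x\<in>space \<nu>. 0 < \<tau> x $ i})"
    using \<tau>(2) unfolding admissible_def conull_def by (intro AE_I[where N = "space \<nu> - (\<Inter>i. {x\<in>space \<nu>. 0 < \<tau> x $ i})"]) auto
  then have "AE x in \<nu>. 0 < K \<alpha> S f x \<and> K \<alpha> S f x < \<infinity>"
    using AE_space
  proof eventually_elim
    case (elim x)
    then have x: "x \<in> space M" and t: "\<tau> x \<in> posG" by (auto simp: sp posG_def)
    have "K \<alpha> S f x \<le> (\<integral>\<^sup>+ r. ennreal (p (r * \<tau> x)) \<partial>theta \<alpha>)"
      unfolding K_def using t
      by (intro nn_integral_mono) (simp add: f_def \<sigma>_def \<tau>_act x ennreal_leI)
    also have "\<dots> = ennreal (chi \<alpha> (\<tau> x)) * (\<integral>\<^sup>+ r. ennreal (p r) \<partial>theta \<alpha>)"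
      using p(1) by (intro nn_integral_theta_scale[OF t]) auto
    also have "\<dots> < \<infinity>"
      using p(3) by (auto simp: ennreal_mult_less_top)
    finally show ?case
      using K_pos[OF f_meas f_pos x] by simp
  qed
  with f_meas f_pos fin pos show ?thesis by blast
qed

section \<open>From finite orbit integrals to gauges\<close>

text \<open>
  For the measure \<open>f (S\<^sub>r x) \<theta>(dr)\<close> on the group, this is the mass of \<open>{r. r\<^sub>i \<le> 1 / s}\<close> when \<open>s > 0\<close>.
  The parameter is \<open>s\<close> and not \<open>1 / s\<close> because the gauge is the reciprocal of a median.
\<close>

definition lower_mass :: "('a \<Rightarrow> real) \<Rightarrow> 'q \<Rightarrow> 'a \<Rightarrow> real \<Rightarrow> ennreal" where
  "lower_mass f i x s = (\<integral>\<^sup>+ r. ennreal (f (S r x)) * indicator {..1} (r $ i * s) \<partial>theta \<alpha>)"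

text \<open>
  The \<open>s > 0\<close> such that \<open>1 / s\<close> is at least the median of the \<open>i\<close>-th coordinate; if the measure is
  nonzero and finite, they form an interval from \<open>0\<close> to the reciprocal of the median.
\<close>

definition median_set :: "('a \<Rightarrow> real) \<Rightarrow> 'q \<Rightarrow> 'a \<Rightarrow> real set" where
  "median_set f i x = {s. 0 < s \<and> K \<alpha> S f x \<le> 2 * lower_mass f i x s}"

text \<open>
  The right end point of the interval \<^const>\<open>median_set\<close> is expressed as its length: in this form
  measurability in \<open>x\<close> is an instance of Fubini's theorem and equivariance is the scaling of Lebesgue
  measure.
\<close>

definition median_gauge :: "('a \<Rightarrow> real) \<Rightarrow> 'a \<Rightarrow> real ^ 'q" where
  "median_gauge f x = (if 0 < K \<alpha> S f x \<and> K \<alpha> S f x < \<infinity>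
     then (\<chi> i. enn2real (\<integral>\<^sup>+ s. indicator (median_set f i x) s \<partial>lborel)) else 0)"

lemma lower_mass_action:
  assumes f: "f \<in> borel_measurable M" and x: "x \<in> space M" and u: "u \<in> posG"
  shows "lower_mass f i (S u x) (u $ i * s) = ennreal (chi \<alpha> u) * lower_mass f i x s"
proof -
  have [measurable]: "(\<lambda>r. f (S r x)) \<in> borel_measurable (theta \<alpha>)"
    by (rule measurable_orbit[OF f x])
  have "lower_mass f i (S u x) (u $ i * s) =
      (\<integral>\<^sup>+ r. ennreal (f (S (r * u) x)) * indicator {..1} ((r * u) $ i * s) \<partial>theta \<alpha>)"
    unfolding lower_mass_def using x u by (intro nn_integral_cong) (simp add: action_mult mult_ac)
  also have "\<dots> = ennreal (chi \<alpha> u) * lower_mass f i x s"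
    unfolding lower_mass_def
    by (rule nn_integral_theta_scale[OF u, where g = "\<lambda>r. ennreal (f (S r x)) * indicator {..1} (r $ i * s)"]) measurable
  finally show ?thesis .
qed

lemma median_set_action:
  assumes f: "f \<in> borel_measurable M" and x: "x \<in> space M" and u: "u \<in> posG"
  shows "u $ i * s \<in> median_set f i (S u x) \<longleftrightarrow> s \<in> median_set f i x"
proof -
  have "K \<alpha> S f (S u x) \<le> 2 * lower_mass f i (S u x) (u $ i * s) \<longleftrightarrow>
      ennreal (chi \<alpha> u) * K \<alpha> S f x \<le> ennreal (chi \<alpha> u) * (2 * lower_mass f i x s)"
    unfolding lower_mass_action[OF assms] K_action[OF assms] by (simp add: mult.left_commute)
  also have "\<dots> \<longleftrightarrow> K \<alpha> S f x \<le> 2 * lower_mass f i x s"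
    using chi_pos[OF u, of \<alpha>] by (intro ennreal_mult_le_mult_iff) auto
  finally show ?thesis
    by (simp add: median_set_def posG_mult_pos_iff[OF u])
qed

lemma measurable_median_indicator:
  assumes f: "f \<in> borel_measurable M"
  shows "(\<lambda>(x, s). indicator (median_set f i x) s :: ennreal) \<in> borel_measurable (M \<Otimes>\<^sub>M lborel)"
proof -
  note measurable_compose[OF _ f, measurable (raw)]
  note measurable_compose[OF _ K_measurable[OF f], measurable (raw)]
  have [measurable]: "(\<lambda>p. lower_mass f i (fst p) (snd p)) \<in> borel_measurable (M \<Otimes>\<^sub>M lborel)"
    unfolding lower_mass_def by measurable
  show ?thesis
    unfolding median_set_def indicator_def split_beta' mem_Collect_eq by measurable
qed

lemma median_gauge_measurable:
  assumes f: "f \<in> borel_measurable M"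
  shows "median_gauge f \<in> borel_measurable M"
proof -
  have [measurable]: "(\<lambda>x. \<integral>\<^sup>+ s. indicator (median_set f i x) s \<partial>lborel :: ennreal) \<in> borel_measurable M" for i
    by (rule lborel.borel_measurable_nn_integral[OF measurable_median_indicator[OF f]])
  note K_measurable[OF f, measurable]
  show ?thesis
    unfolding borel_measurable_vec_iff
  proof
    fix i
    show "(\<lambda>x. median_gauge f x $ i) \<in> borel_measurable M"
      unfolding median_gauge_def if_distrib[of "\<lambda>v. v $ i"] vec_lambda_beta zero_index by measurable
  qed
qed

lemma median_gauge_product_gauge:
  assumes f: "f \<in> borel_measurable M"
  shows "product_gauge M S (median_gauge f)"
  unfolding product_gauge_def
proof (intro conjI ballI allI median_gauge_measurable[OF f])
  fix x i show "0 \<le> median_gauge f x $ i"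
    by (simp add: median_gauge_def)
next
  fix u :: "real ^ 'q" and x assume u: "u \<in> posG" and x: "x \<in> space M"
  have "(\<integral>\<^sup>+ s. indicator (median_set f i (S u x)) s \<partial>lborel) =
      ennreal (u $ i) * (\<integral>\<^sup>+ s. indicator (median_set f i x) s \<partial>lborel)" for i
  proof -
    have ui: "0 < u $ i" using u by (simp add: posG_def)
    have m: "(\<lambda>s. indicator (median_set f i (S u x)) s :: ennreal) \<in> borel_measurable borel"
      using measurable_compose[OF measurable_Pair1' measurable_median_indicator[OF f, of i], of "S u x"] x u
      by simp
    have "(\<integral>\<^sup>+ s. indicator (median_set f i (S u x)) s \<partial>lborel) =
        ennreal (u $ i) * (\<integral>\<^sup>+ s. indicator (median_set f i (S u x)) (0 + u $ i * s) \<partial>lborel)"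
      using ui by (subst nn_integral_real_affine[OF m, of "u $ i" 0]) auto
    also have "(\<integral>\<^sup>+ s. indicator (median_set f i (S u x)) (0 + u $ i * s) \<partial>lborel) =
        (\<integral>\<^sup>+ s. indicator (median_set f i x) s \<partial>lborel :: ennreal)"
      by (intro nn_integral_cong) (simp add: indicator_def median_set_action[OF f x u])
    finally show ?thesis .
  qed
  then show "median_gauge f (S u x) = u * median_gauge f x"
    using u by (auto simp: vec_eq_iff median_gauge_def K_finite_action[OF f x u] enn2real_mult posG_def less_imp_le)
qed

text \<open>
  Both are dominated convergence with \<open>f (S\<^sub>r x)\<close> as the bound: no mass of \<open>\<theta>\<close> sits at vectors with a
  coordinate \<open>0\<close> or \<open>\<infinity>\<close>.
\<close>

lemma lower_mass_limits:
  assumes f: "f \<in> borel_measurable M" and x: "x \<in> space M" and K: "K \<alpha> S f x < \<infinity>"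
  shows "(\<lambda>n. lower_mass f i x (1 / real (Suc n))) \<longlonglongrightarrow> K \<alpha> S f x"
    and "(\<lambda>n. lower_mass f i x (real (Suc n))) \<longlonglongrightarrow> 0"
proof -
  note m[measurable] = measurable_orbit[OF f x]
  have dom: "(\<lambda>n. lower_mass f i x (s n)) \<longlonglongrightarrow> (\<integral>\<^sup>+ r. ennreal (f (S r x)) * l \<partial>theta \<alpha>)"
    if "\<And>r. r \<in> posG \<Longrightarrow> eventually (\<lambda>n. indicator {..1} (r $ i * s n) = l) sequentially"
    for s :: "nat \<Rightarrow> real" and l :: ennreal
    unfolding lower_mass_def
  proof (rule nn_integral_dominated_convergence[where w = "\<lambda>r. ennreal (f (S r x))"])
    show "AE r in theta \<alpha>. (\<lambda>n. ennreal (f (S r x)) * indicator {..1} (r $ i * s n)) \<longlonglongrightarrow> ennreal (f (S r x)) * l"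
    proof (rule AE_I2)
      fix r assume "r \<in> space (theta \<alpha>)"
      then have "eventually (\<lambda>n. indicator {..1} (r $ i * s n) = l) sequentially"
        using that by simp
      then show "(\<lambda>n. ennreal (f (S r x)) * indicator {..1} (r $ i * s n)) \<longlonglongrightarrow> ennreal (f (S r x)) * l"
        by (intro tendsto_eventually) (auto elim: eventually_mono)
    qed
  qed (use K in \<open>auto simp: K_def indicator_def\<close>)
  have "eventually (\<lambda>n. indicator {..1} (r $ i * (1 / real (Suc n))) = (1 :: ennreal)) sequentially"
    if r: "r \<in> posG" for r
    using eventually_ge_at_top[of "nat \<lceil>r $ i\<rceil>"]
  proof eventually_elim
    case (elim n)
    then have "r $ i \<le> real (Suc n)" by linarith
    then show ?case by (simp add: indicator_def field_simps)
  qed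
  from dom[OF this] show "(\<lambda>n. lower_mass f i x (1 / real (Suc n))) \<longlonglongrightarrow> K \<alpha> S f x"
    by (simp add: K_def)
  have "eventually (\<lambda>n. indicator {..1} (r $ i * real (Suc n)) = (0 :: ennreal)) sequentially"
    if r: "r \<in> posG" for r
    using eventually_ge_at_top[of "nat \<lceil>1 / r $ i\<rceil>"]
  proof eventually_elim
    case (elim n)
    then have "1 / r $ i < real (Suc n)" by linarith
    with r have "1 < r $ i * real (Suc n)" by (simp add: posG_def field_simps)
    then show ?case by (simp add: indicator_def)
  qed
  from dom[OF this] show "(\<lambda>n. lower_mass f i x (real (Suc n))) \<longlonglongrightarrow> 0"
    by simp
qed

lemma lower_mass_antimono:
  assumes "s \<le> t"
  shows "lower_mass f i x t \<le> lower_mass f i x s"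
  unfolding lower_mass_def
proof (intro nn_integral_mono mult_left_mono)
  fix r :: "real ^ 'q" assume "r \<in> space (theta \<alpha>)"
  then have "r $ i * s \<le> r $ i * t"
    using assms by (intro mult_left_mono) (auto simp: posG_def less_imp_le)
  then show "indicator {..1} (r $ i * t) \<le> (indicator {..1} (r $ i * s) :: ennreal)"
    by (auto simp: indicator_def)
qed simp

text \<open>
  More than half of the mass lies below \<open>r\<^sub>i = m + 1\<close> for some \<open>m\<close>, and less than half below
  \<open>r\<^sub>i = 1 / (n + 1)\<close> for some \<open>n\<close>.  So the median set contains a nondegenerate interval at \<open>0\<close> and is
  bounded, hence its length is positive and finite.
\<close>

lemma median_gauge_pos:
  assumes f: "f \<in> borel_measurable M" and x: "x \<in> space M"
    and K: "0 < K \<alpha> S f x" "K \<alpha> S f x < \<infinity>"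
  shows "0 < median_gauge f x $ i"
proof -
  obtain k where k: "K \<alpha> S f x = ennreal k" "0 < k"
    using K by (cases "K \<alpha> S f x") auto
  have "2 * ennreal (k / 2) = ennreal 2 * ennreal (k / 2)"
    by simp
  also have "\<dots> = K \<alpha> S f x"
    using k by (subst ennreal_mult[symmetric]) auto
  finally have half: "ennreal (k / 2) < K \<alpha> S f x" "0 < ennreal (k / 2)" "2 * ennreal (k / 2) = K \<alpha> S f x"
    using k(2) unfolding k(1) by (simp_all only: ennreal_less_iff) auto
  have "eventually (\<lambda>n. ennreal (k / 2) < lower_mass f i x (1 / real (Suc n))) sequentially"
    using order_tendstoD(1)[OF lower_mass_limits(1)[OF f x K(2)] half(1)] .
  then obtain m where m: "ennreal (k / 2) < lower_mass f i x (1 / real (Suc m))"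
    by (auto simp: eventually_sequentially)
  have "eventually (\<lambda>n. lower_mass f i x (real (Suc n)) < ennreal (k / 2)) sequentially"
    using order_tendstoD(2)[OF lower_mass_limits(2)[OF f x K(2)] half(2)] .
  then obtain n where n: "lower_mass f i x (real (Suc n)) < ennreal (k / 2)"
    by (auto simp: eventually_sequentially)
  have lo: "{0<..1 / real (Suc m)} \<subseteq> median_set f i x"
  proof
    fix s assume s: "s \<in> {0<..1 / real (Suc m)}"
    then have "ennreal (k / 2) \<le> lower_mass f i x s"
      using lower_mass_antimono[of s "1 / real (Suc m)" f i x] m by auto
    then have "2 * ennreal (k / 2) \<le> 2 * lower_mass f i x s"
      by (intro mult_left_mono) auto
    then show "s \<in> median_set f i x"
      using s half(3) by (simp add: median_set_def)
  qed
  have hi: "median_set f i x \<subseteq> {0<..real (Suc n)}"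
  proof
    fix s assume s: "s \<in> median_set f i x"
    have "s \<le> real (Suc n)"
    proof (rule ccontr)
      assume "\<not> s \<le> real (Suc n)"
      then have "lower_mass f i x s < ennreal (k / 2)"
        using lower_mass_antimono[of "real (Suc n)" s f i x] n by auto
      then have "2 * lower_mass f i x s < 2 * ennreal (k / 2)"
        by (intro ennreal_mult_strict_left_mono) auto
      moreover have "2 * ennreal (k / 2) \<le> 2 * lower_mass f i x s"
        using s unfolding half(3) by (simp add: median_set_def)
      ultimately show False using leD by blast
    qed
    with s show "s \<in> {0<..real (Suc n)}" by (simp add: median_set_def)
  qed
  let ?I = "\<integral>\<^sup>+ s. indicator (median_set f i x) s \<partial>lborel :: ennreal"
  have "ennreal (1 / real (Suc m)) = (\<integral>\<^sup>+ s. indicator {0<..1 / real (Suc m)} s \<partial>lborel)"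
    by simp
  also have "\<dots> \<le> ?I"
    using lo by (intro nn_integral_mono) (auto simp: indicator_def)
  finally have "0 < ?I" by (rule less_le_trans[rotated]) simp
  moreover have "?I \<le> (\<integral>\<^sup>+ s. indicator {0<..real (Suc n)} s \<partial>lborel)"
    using hi by (intro nn_integral_mono) (auto simp: indicator_def)
  then have "?I < top" by (rule le_less_trans) simp
  ultimately show ?thesis
    using K by (simp add: median_gauge_def enn2real_positive_iff)
qed

lemma admissible_median_gauge:
  assumes sets: "sets \<nu> = sets M" and f: "f \<in> borel_measurable M"
    and K: "AE x in \<nu>. 0 < K \<alpha> S f x \<and> K \<alpha> S f x < \<infinity>"
  shows "admissible \<nu> (median_gauge f)"
proof -
  have sp: "space \<nu> = space M" using sets by (rule sets_eq_imp_space_eq)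
  note sets[measurable_cong] median_gauge_measurable[OF f, measurable]
  let ?E = "\<Inter>i. {x\<in>space \<nu>. 0 < median_gauge f x $ i}"
  have E: "?E \<in> sets \<nu>" by measurable
  have "AE x in \<nu>. x \<in> ?E"
    using K AE_space by eventually_elim (auto simp: sp median_gauge_pos[OF f])
  then have "emeasure \<nu> (space \<nu> - ?E) = 0"
    using E by (subst (asm) AE_iff_measurable[where N = "space \<nu> - ?E"]) auto
  with E show ?thesis
    by (simp add: admissible_def conull_def)
qed

section \<open>Countable families of coordinate gauges\<close>

text \<open>
  Multiplication by \<open>r\<^sub>i > 0\<close> does not affect the sign of \<open>g n i\<close>, so the first index at which it is
  positive is constant on orbits.
\<close>

lemma gauge_of_sequences:
  fixes g :: "nat \<Rightarrow> 'q \<Rightarrow> 'a \<Rightarrow> real"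
  assumes sets: "sets \<nu> = sets M"
    and g: "\<And>i n. n \<ge> 1 \<Longrightarrow> g n i \<in> borel_measurable M"
      "\<And>i n x. n \<ge> 1 \<Longrightarrow> x \<in> space M \<Longrightarrow> 0 \<le> g n i x"
      "\<And>i n r x. n \<ge> 1 \<Longrightarrow> r \<in> posG \<Longrightarrow> x \<in> space M \<Longrightarrow> g n i (S r x) = r $ i * g n i x"
    and con: "conull \<nu> (\<Inter>i. \<Union>n\<in>{1..}. {x\<in>space M. 0 < g n i x})"
  shows "\<exists>\<tau>. product_gauge M S \<tau> \<and> admissible \<nu> \<tau>"
proof -
  have sp: "space \<nu> = space M" using sets by (rule sets_eq_imp_space_eq)
  (* Indices are shifted, as the sequences start at 1.  Where no g n i x is positive, every choice of
     index gives the value 0. *)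
  define N :: "'q \<Rightarrow> 'a \<Rightarrow> nat" where "N i x = (LEAST n. 0 < g (Suc n) i x)" for i x
  define \<tau> :: "'a \<Rightarrow> real ^ 'q" where "\<tau> x = (\<chi> i. g (Suc (N i x)) i x)" for x
  note [measurable] = g(1)[of "Suc _", simplified]
  have "\<tau> \<in> borel_measurable M"
    unfolding borel_measurable_vec_iff \<tau>_def N_def by (simp, measurable)
  moreover have "\<tau> (S r x) = r * \<tau> x" if "r \<in> posG" "x \<in> space M" for r x
    using that by (simp add: \<tau>_def N_def vec_eq_iff g(3) posG_mult_pos_iff)
  ultimately have "product_gauge M S \<tau>"
    by (auto simp: product_gauge_def \<tau>_def g(2))
  moreover have "0 < \<tau> x $ i \<longleftrightarrow> (\<exists>n\<ge>1. 0 < g n i x)" if "x \<in> space M" for x i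
  proof
    assume "\<exists>n\<ge>1. 0 < g n i x"
    then obtain n where "0 < g (Suc n) i x"
      by (metis Suc_le_D One_nat_def)
    then show "0 < \<tau> x $ i" by (simp add: \<tau>_def N_def) (rule LeastI)
  qed (auto simp: \<tau>_def)
  then have "(\<Inter>i. {x\<in>space \<nu>. 0 < \<tau> x $ i}) = (\<Inter>i. \<Union>n\<in>{1..}. {x\<in>space M. 0 < g n i x})"
    by (fastforce simp: sp)
  with con have "admissible \<nu> \<tau>" by (simp add: admissible_def)
  ultimately show ?thesis by blast
qed

end

theorem theorem2p2:
  fixes M :: "'a measure"
    and S :: "real ^ 'q \<Rightarrow> 'a \<Rightarrow> 'a"
    and \<alpha> :: "real ^ 'q"
    and \<nu> :: "'a measure"
  assumes "action M S"
    and "\<alpha> \<in> posG"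
    and "\<nu> \<in> homogeneous_measures \<alpha> M S"
  shows
    "((\<exists>(P :: 'a measure) Z. prob_space P \<and> Z \<in> P \<rightarrow>\<^sub>M M \<and>
          (\<forall>A\<in>sets M. emeasure \<nu> A = nu_of \<alpha> S P Z A))
       \<longleftrightarrow> (\<exists>\<tau>. product_gauge M S \<tau> \<and> admissible \<nu> \<tau>)) \<and>
     ((\<exists>f :: 'a \<Rightarrow> real. f \<in> borel_measurable M \<and> (\<forall>x\<in>space M. 0 < f x) \<and>
          0 < (\<integral>\<^sup>+ x. ennreal (f x) \<partial>\<nu>) \<and> (\<integral>\<^sup>+ x. ennreal (f x) \<partial>\<nu>) < \<infinity> \<and>
          (AE x in \<nu>. 0 < K \<alpha> S f x \<and> K \<alpha> S f x < \<infinity>))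
       \<longleftrightarrow> (\<exists>\<tau>. product_gauge M S \<tau> \<and> admissible \<nu> \<tau>)) \<and>
     ((\<exists>g :: nat \<Rightarrow> 'q \<Rightarrow> 'a \<Rightarrow> real.
          (\<forall>i. \<forall>n\<ge>1. g n i \<in> borel_measurable M \<and> (\<forall>x\<in>space M. 0 \<le> g n i x) \<and>
             (\<forall>r\<in>posG. \<forall>x\<in>space M. g n i (S r x) = r $ i * g n i x)) \<and>
          conull \<nu> (\<Inter>i. \<Union>n\<in>{1..}. {x\<in>space M. 0 < g n i x}))
       \<longleftrightarrow> (\<exists>\<tau>. product_gauge M S \<tau> \<and> admissible \<nu> \<tau>))"
    (is "(?i \<longleftrightarrow> ?iii) \<and> (?ii \<longleftrightarrow> ?iii) \<and> (?iv \<longleftrightarrow> ?iii)")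
proof -
  interpret homogeneous_action M S \<alpha> by unfold_locales fact+
  have sets: "sets \<nu> = sets M" and nz: "emeasure \<nu> (space M) \<noteq> 0"
    and sf: "sigma_finite_measure \<nu>" and hom: "homogeneous \<alpha> M S \<nu>"
    using assms(3) by (auto simp: homogeneous_measures_def)
  have sp: "space \<nu> = space M" using sets by (rule sets_eq_imp_space_eq)
  have ii_iii: ?iii if ?ii
    using that median_gauge_product_gauge admissible_median_gauge[OF sets] by blast
  have iii_ii: ?ii if ?iii
    using that finite_K_of_gauge[OF sets sf nz] by blast
  have ii_i: ?i if ?ii
    using that random_element_of_finite_K[OF sets hom sf] by blast
  have i_iii: ?iii if i: ?i
  proof -
    from i obtain P :: "'a measure" and Z where P: "prob_space P" "Z \<in> P \<rightarrow>\<^sub>M M"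
      and \<nu>: "\<And>A. A \<in> sets M \<Longrightarrow> emeasure \<nu> A = nu_of \<alpha> S P Z A" by blast
    obtain f :: "'a \<Rightarrow> real" where "f \<in> borel_measurable \<nu>" "\<forall>x. 0 < f x"
      "(\<integral>\<^sup>+ x. ennreal (f x) \<partial>\<nu>) < \<infinity>"
      using sigma_finite_positive_integrable_exists[OF sf] by (elim exE conjE)
    then have f: "f \<in> borel_measurable M" "\<And>x. 0 < f x" "(\<integral>\<^sup>+ x. ennreal (f x) \<partial>\<nu>) < \<infinity>"
      by (simp_all add: measurable_cong_sets[OF sets refl])
    have "AE x in \<nu>. K \<alpha> S f x < \<infinity>"
      using P f(1,3) by (intro K_finite_of_random_element[OF sets _ P(2) \<nu>]) (auto intro: prob_space_imp_sigma_finite)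
    then have "AE x in \<nu>. 0 < K \<alpha> S f x \<and> K \<alpha> S f x < \<infinity>"
      using AE_space by eventually_elim (auto simp: sp K_pos[OF f(1,2)])
    with median_gauge_product_gauge admissible_median_gauge[OF sets] f(1) show ?iii by blast
  qed
  have iii_iv: ?iv if iii: ?iii
  proof -
    from iii obtain \<tau> where \<tau>: "product_gauge M S \<tau>" "admissible \<nu> \<tau>" by blast
    then have "conull \<nu> (\<Inter>i. \<Union>n\<in>{1 :: nat..}. {x\<in>space M. 0 < \<tau> x $ i})"
      by (simp add: admissible_def sp)
    with \<tau>(1) show ?iv
      by (intro exI[of _ "\<lambda>n i x. \<tau> x $ i"]) (auto simp: product_gauge_def intro: measurable_vec_nth)
  qed
  have iv_iii: ?iii if iv: ?iv
  proof -
    from iv obtain g :: "nat \<Rightarrow> 'q \<Rightarrow> 'a \<Rightarrow> real" where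
      "\<forall>i. \<forall>n\<ge>1. g n i \<in> borel_measurable M \<and> (\<forall>x\<in>space M. 0 \<le> g n i x) \<and>
             (\<forall>r\<in>posG. \<forall>x\<in>space M. g n i (S r x) = r $ i * g n i x)"
      "conull \<nu> (\<Inter>i. \<Union>n\<in>{1..}. {x\<in>space M. 0 < g n i x})" by blast
    then show ?iii by (intro gauge_of_sequences[OF sets, of g]) auto
  qed
  from ii_iii iii_ii ii_i i_iii iii_iv iv_iii show ?thesis by argo
qed

end
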